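(* For any $t,\tau\in\mathbb{R}_{\ge 0}$ one has $\mu_t\,\mathbf{L}_\tau=\mu_{e^{-\tau}t}$; that is, for every $\mathbf{x}\in\mathcal{C}$, $$\sum_{\mathbf{y}\in\mathcal{C}}\mu_t(\mathbf{y})\,\mathbf{L}_\tau(\mathbf{y},\mathbf{x})=\mu_{e^{-\tau}t}(\mathbf{x}).$$
   Context: $\mathcal{C}$ is the countable set of particle configurations $\mathbf{x}=\{x_1>x_2>x_3>\dots\}\subset\mathbb{Z}$ (at most one particle per site, with a rightmost particle $x_1$) such that $x_N=-N$ for all sufficiently large $N$. The step configuration is $x_N=-N$ for all $N\ge 1$. TASEP: the continuous-time Markov process on $\mathcal{C}$ in which each particle has an independent exponential clock of rate $1$; when the clock rings, the particle jumps to the right by one if the destination site is empty, and otherwise nothing happens. $\mu_t$ denotes the distribution at time $t\ge 0$ of the TASEP started at time $0$ from the step configuration (a probability measure on $\mathcal{C}$). Backwards Hammersley-type process (BHP): the time-homogeneous continuous-time Markov chain on $\mathcal{C}$ in which, at each hole (empty site), there is an independent exponential clock whose rate equals the number of particles to the right of this hole; when the clock at a hole rings, the leftmost of the particles to the right of the hole instantaneously jumps into this hole. (Equivalently, each particle $x_k$ jumps to each of the holes $x_{k+1}+1,\dots,x_k-1$ at rate $k$ per hole.) From each initial configuration only finitely many states are reachable, so the chain is well defined. $\mathbf{L}_\tau(\mathbf{x},\mathbf{y})$, $\tau\ge 0$, denotes its transition probability from $\mathbf{x}\in\mathcal{C}$ to $\mathbf{y}\in\mathcal{C}$ in time $\tau$.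 *)

theory Defs
  imports "HOL-Probability.Probability"
begin

section \<open>Continuous-time Markov chains driven by exponential clocks\<close>

text \<open>
  In state \<open>x\<close> the clocks \<open>c\<close> with \<open>rate x c > 0\<close> are running independently, clock \<open>c\<close> being
  exponential of rate \<open>rate x c\<close>. The first clock \<open>c\<close> to ring moves the chain to \<open>move x c\<close>, and
  then fresh clocks are started in the new state; by memorylessness this is the same as letting
  the other clocks run on with their rates adjusted to the new state.

  The randomness \<open>\<omega> n c\<close> is independent standard exponential, so that \<open>\<omega> n c / rate x c\<close> is
  exponential of rate \<open>rate x c\<close>. The definitions are meant for states in which only finitely many
  clocks are running, so that there is a (first) minimal ring time.
\<close>

definition exp_clocks :: "(nat \<Rightarrow> 'c \<Rightarrow> real) measure" where
  "exp_clocks =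
     (\<Pi>\<^sub>M n\<in>UNIV. \<Pi>\<^sub>M c\<in>UNIV. density lborel (\<lambda>s. ennreal (exponential_density 1 s)))"

definition running :: "('a \<Rightarrow> 'c \<Rightarrow> real) \<Rightarrow> 'a \<Rightarrow> 'c set" where
  "running rate x = {c. rate x c > 0}"

text \<open>The infimum is \<open>\<infinity>\<close> if no clock is running, that is, if \<open>x\<close> is absorbing.\<close>

definition holding_time :: "('a \<Rightarrow> 'c \<Rightarrow> real) \<Rightarrow> 'a \<Rightarrow> ('c \<Rightarrow> real) \<Rightarrow> ennreal" where
  "holding_time rate x e = (INF c\<in>running rate x. ennreal (e c / rate x c))"

definition next_state ::
    "('a \<Rightarrow> 'c \<Rightarrow> real) \<Rightarrow> ('a \<Rightarrow> 'c \<Rightarrow> 'a) \<Rightarrow> 'a \<Rightarrow> ('c \<Rightarrow> real) \<Rightarrow> 'a" where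
  "next_state rate move x e =
     (if running rate x = {} then x
      else move x (arg_min_on (\<lambda>c. e c / rate x c) (running rate x)))"

primrec jump_chain ::
    "('a \<Rightarrow> 'c \<Rightarrow> real) \<Rightarrow> ('a \<Rightarrow> 'c \<Rightarrow> 'a) \<Rightarrow> 'a \<Rightarrow> (nat \<Rightarrow> 'c \<Rightarrow> real) \<Rightarrow> nat \<Rightarrow> 'a" where
  "jump_chain rate move x \<omega> 0 = x"
| "jump_chain rate move x \<omega> (Suc n) = next_state rate move (jump_chain rate move x \<omega> n) (\<omega> n)"

definition jump_time ::
    "('a \<Rightarrow> 'c \<Rightarrow> real) \<Rightarrow> ('a \<Rightarrow> 'c \<Rightarrow> 'a) \<Rightarrow> 'a \<Rightarrow> (nat \<Rightarrow> 'c \<Rightarrow> real) \<Rightarrow> nat \<Rightarrow> ennreal" where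
  "jump_time rate move x \<omega> n = (\<Sum>i<n. holding_time rate (jump_chain rate move x \<omega> i) (\<omega> i))"

definition state_at ::
    "('a \<Rightarrow> 'c \<Rightarrow> real) \<Rightarrow> ('a \<Rightarrow> 'c \<Rightarrow> 'a) \<Rightarrow> 'a \<Rightarrow> (nat \<Rightarrow> 'c \<Rightarrow> real) \<Rightarrow> real \<Rightarrow> 'a \<Rightarrow> bool" where
  "state_at rate move x \<omega> t y \<longleftrightarrow>
     (\<exists>n. jump_time rate move x \<omega> n \<le> ennreal t \<and> ennreal t < jump_time rate move x \<omega> (Suc n)
        \<and> jump_chain rate move x \<omega> n = y)"

definition transition_prob ::
    "('a \<Rightarrow> 'c \<Rightarrow> real) \<Rightarrow> ('a \<Rightarrow> 'c \<Rightarrow> 'a) \<Rightarrow> real \<Rightarrow> 'a \<Rightarrow> 'a \<Rightarrow> real" where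
  "transition_prob rate move t x y = \<P>(\<omega> in exp_clocks. state_at rate move x \<omega> t y)"


section \<open>Particle configurations\<close>

text \<open>A configuration \<open>x 1 > x 2 > \<dots>\<close> is represented by its set of occupied sites.\<close>

definition configs :: "int set set" where
  "configs = {x ` {1..} | x :: nat \<Rightarrow> int.
     (\<forall>i\<ge>1. x (Suc i) < x i) \<and> (\<forall>\<^sub>F N in sequentially. x N = - int N)}"

definition step_config :: "int set" where
  "step_config = (\<lambda>N::nat. - int N) ` {1..}"


section \<open>TASEP\<close>

text \<open>
  Clocks are labelled by the site of the particle. The ring of a clock at a blocked particle has no
  effect, so only the (finitely many) clocks of particles that are free to jump are kept.
\<close>

definition tasep_rate :: "int set \<Rightarrow> int \<Rightarrow> real" where
  "tasep_rate x p = (if p \<in> x \<and> p + 1 \<notin> x then 1 else 0)"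

definition tasep_move :: "int set \<Rightarrow> int \<Rightarrow> int set" where
  "tasep_move x p = insert (p + 1) (x - {p})"

definition tasep_law :: "real \<Rightarrow> int set \<Rightarrow> real" where
  "tasep_law t = transition_prob tasep_rate tasep_move t step_config"


section \<open>The backwards Hammersley-type process\<close>

text \<open>
  Clocks are labelled by the holes. Only finitely many particles of a configuration lie to the right
  of a given hole.
\<close>

definition bhp_rate :: "int set \<Rightarrow> int \<Rightarrow> real" where
  "bhp_rate x h = (if h \<notin> x then real (card {p \<in> x. h < p}) else 0)"

definition bhp_move :: "int set \<Rightarrow> int \<Rightarrow> int set" where
  "bhp_move x h = insert h (x - {Min {p \<in> x. h < p}})"

definition bhp_trans :: "real \<Rightarrow> int set \<Rightarrow> int set \<Rightarrow> real" where
  "bhp_trans = transition_prob bhp_rate bhp_move"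

end

theory Submission imports Defs begin

text \<open>
  The generators \<open>T\<close> of TASEP and \<open>B\<close> of the BHP satisfy \<open>B T - T B = T\<close> on all configurations.
  Hence \<open>T L\<^sub>\<tau> = exp (- \<tau>) L\<^sub>\<tau> T\<close>, since both sides, multiplied by \<open>exp \<tau>\<close>, solve the
  backward equation of the BHP with the same initial value, and this equation is triangular with
  respect to the area of a configuration. It follows that \<open>L\<^sub>\<tau> P\<^sub>s\<close> with \<open>s = exp (- \<tau>) t\<close> solves, as a
  function of \<open>t\<close>, the backward equation of TASEP, as does \<open>P\<^sub>t L\<^sub>\<tau>\<close>. As the jump rate of TASEP
  grows at most linearly in the area, bounded solutions are unique, so that
  \<open>P\<^sub>t L\<^sub>\<tau> = L\<^sub>\<tau> P\<^sub>s\<close>. Finally, the step configuration is absorbing for the BHP.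
\<close>

section \<open>The first jump of a chain driven by exponential clocks\<close>

text \<open>For a fixed target \<open>x\<close>, everything is treated as a function of the initial
  state: conditioning on the first jump yields the backward equation, which involves only the
  finitely many moves out of one state. The commutator relation makes \<open>T\<close> an
  eigenvector of commutation with \<open>B\<close>, so conjugation by the semigroup of
  \<open>B\<close> rescales \<open>T\<close> by a factor; this is the source of the time change. The
  two chains move the area in opposite directions, and this shapes the analysis. The BHP lowers it,
  so its sums are finite. TASEP raises it, so \<open>P\<^sub>t L\<^sub>\<tau>\<close> is an infinite
  sum over the intermediate state. That sum is truncated to intermediate area at most
  \<open>N\<close>. Each truncation solves the TASEP backward equation exactly, and its initial
  value can be wrong only at states of area above \<open>N\<close>. There the error is at most 1,
  hence at most \<open>(area + 2) / (N + 2)\<close>; the comparison propagates this bound in time,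
  and \<open>N\<close> tends to infinity.\<close>

abbreviation unit_exp :: "real measure" where
  "unit_exp \<equiv> density lborel (\<lambda>s. ennreal (exponential_density 1 s))"

abbreviation clock_space :: "('c \<Rightarrow> real) measure" where
  "clock_space \<equiv> Pi\<^sub>M UNIV (\<lambda>_. unit_exp)"

lemma prob_space_unit_exp: "prob_space unit_exp"
  by (rule prob_space_exponential_density) simp

lemma prob_space_clock_space: "prob_space clock_space"
  by (intro prob_space_PiM prob_space_unit_exp)

lemma emeasure_unit_exp_greaterThan:
  assumes "0 \<le> a"
  shows "emeasure unit_exp {a<..} = ennreal (exp (- a))"
proof -
  interpret prob_space unit_exp by (rule prob_space_unit_exp)
  have "distributed unit_exp lborel (\<lambda>x. x) (exponential_density 1)"
    unfolding distributed_def by (auto simp: distr_id2 intro!: distr_id2)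
  from exponential_distributedD_gt[OF this assms] show ?thesis
    by (simp add: emeasure_eq_measure greaterThan_def)
qed

lemma measurable_clock: "(\<lambda>e. e k) \<in> borel_measurable clock_space"
  using measurable_component_singleton[of k UNIV "\<lambda>_. unit_exp"] by simp

text \<open>Condition on the ring time \<open>s\<close> of clock \<open>k\<close>, which has density
  \<open>r k * exp (- r k * s)\<close>. By independence each other clock \<open>j\<close> is still
  silent at time \<open>s\<close> with probability \<open>exp (- r j * s)\<close>, and the exponents
  add up to \<open>sum r K\<close>. The function \<open>g\<close> stands for whatever happens after
  the ring.\<close>

lemma first_ring:
  fixes r :: "'c \<Rightarrow> real" and g :: "real \<Rightarrow> ennreal"
  assumes K: "finite K" "k \<in> K" and r: "\<And>j. j \<in> K \<Longrightarrow> r j > 0"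
    and g[measurable]: "g \<in> borel_measurable borel"
  shows "(\<integral>\<^sup>+e. (if \<forall>j\<in>K - {k}. e k / r k < e j / r j then g (e k / r k) else 0) \<partial>clock_space)
       = (\<integral>\<^sup>+s. ennreal (r k * exp (- sum r K * s)) * g s * indicator {0..} s \<partial>lborel)"
proof -
  let ?J = "K - {k}" and ?R = "Pi\<^sub>M (UNIV - {k}) (\<lambda>_. unit_exp)"
  define F where "F = (\<lambda>e. if \<forall>j\<in>?J. e k / r k < e j / r j then g (e k / r k) else 0)"
  interpret P: product_prob_space "\<lambda>_. unit_exp" "UNIV - {k}"
    by (simp add: product_prob_space_def product_sigma_finite_def prob_space_unit_exp
        product_prob_space_axioms_def prob_space_imp_sigma_finite)
  note K(1)[simp] have fJ: "finite ?J" by simp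
  have meas[measurable]: "F \<in> borel_measurable clock_space"
  proof -
    have "Measurable.pred clock_space (\<lambda>e. e k / r k < e j / r j)" for j
      using measurable_clock[of k] measurable_clock[of j] by measurable
    then have [measurable]: "Measurable.pred clock_space (\<lambda>e. \<forall>j\<in>?J. e k / r k < e j / r j)"
      by (intro pred_intros_finite fJ)
    note measurable_clock[of k, measurable]
    show ?thesis unfolding F_def by measurable
  qed
  have eq: "clock_space = distr (unit_exp \<Otimes>\<^sub>M ?R) clock_space (\<lambda>(x, X). X(k := x))"
    using distr_pair_PiM_eq_PiM[of "UNIV - {k}" "\<lambda>_. unit_exp" k] prob_space_unit_exp by simp
  have m2: "(\<lambda>(x, X). X(k := x)) \<in> measurable (unit_exp \<Otimes>\<^sub>M ?R) clock_space"
    using measurable_compose[OF measurable_pair_swap' measurable_add_dim[of k "UNIV - {k}" "\<lambda>_. unit_exp"]]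
    by (simp add: split_beta' insert_absorb)
  have inner: "(\<integral>\<^sup>+X. F (X(k := u)) \<partial>?R) = g (u / r k) * ennreal (exp (- (sum r ?J / r k) * u))"
    if "0 \<le> u" for u
  proof -
    have "(\<integral>\<^sup>+X. F (X(k := u)) \<partial>?R) =
      (\<integral>\<^sup>+X. g (u / r k) * indicator {X \<in> space ?R. \<forall>j\<in>?J. X j \<in> {u * r j / r k<..}} X \<partial>?R)"
    proof (rule nn_integral_cong)
      fix X assume X: "X \<in> space ?R"
      have "(\<forall>j\<in>?J. u / r k < X j / r j) \<longleftrightarrow> (\<forall>j\<in>?J. X j \<in> {u * r j / r k<..})"
        using r K by (auto simp: field_simps)
      then show "F (X(k := u)) = g (u / r k) * indicator {X \<in> space ?R. \<forall>j\<in>?J. X j \<in> {u * r j / r k<..}} X"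
        using X by (auto simp: F_def)
    qed
    also have "\<dots> = g (u / r k) * emeasure ?R {X \<in> space ?R. \<forall>j\<in>?J. X j \<in> {u * r j / r k<..}}"
    proof (rule nn_integral_cmult_indicator)
      have "{X \<in> space ?R. X j \<in> {u * r j / r k<..}} \<in> sets ?R" if "j \<in> ?J" for j
        using that by (intro sets_Collect_single') auto
      then show "{X \<in> space ?R. \<forall>j\<in>?J. X j \<in> {u * r j / r k<..}} \<in> sets ?R"
        by (rule sets.sets_Collect_finite_All[OF _ fJ])
    qed
    also have "emeasure ?R {X \<in> space ?R. \<forall>j\<in>?J. X j \<in> {u * r j / r k<..}} = (\<Prod>j\<in>?J. emeasure unit_exp {u * r j / r k<..})"
      by (rule P.emeasure_PiM_Collect) auto
    also have "\<dots> = (\<Prod>j\<in>?J. ennreal (exp (- (u * r j / r k))))"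
      using that r K by (intro prod.cong emeasure_unit_exp_greaterThan) (auto simp: less_imp_le)
    also have "\<dots> = ennreal (\<Prod>j\<in>?J. (exp (- (u * r j / r k))))"
      by (rule prod_ennreal) auto
    also have "(\<Prod>j\<in>?J. (exp (- (u * r j / r k)))) = exp (- (sum r ?J / r k) * u)"
      by (simp add: exp_sum[symmetric] sum_negf sum_distrib_left sum_divide_distrib mult.commute)
    finally show ?thesis .
  qed
  have "(\<integral>\<^sup>+e. F e \<partial>clock_space) = (\<integral>\<^sup>+z. F (case z of (x, X) \<Rightarrow> X(k := x)) \<partial>(unit_exp \<Otimes>\<^sub>M ?R))"
    by (subst eq, subst nn_integral_distr[OF m2]) (auto intro!: meas)
  also have "\<dots> = (\<integral>\<^sup>+u. (\<integral>\<^sup>+X. F (X(k := u)) \<partial>?R) \<partial>unit_exp)"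
  proof -
    have "(\<lambda>z. F (case z of (x, X) \<Rightarrow> X(k := x))) \<in> borel_measurable (unit_exp \<Otimes>\<^sub>M ?R)"
      using measurable_compose[OF m2 meas] by simp
    from P.P.nn_integral_fst[OF this] show ?thesis by simp
  qed
  also have "\<dots> = (\<integral>\<^sup>+u. ennreal (exponential_density 1 u) * (\<integral>\<^sup>+X. F (X(k := u)) \<partial>?R) \<partial>lborel)"
  proof (rule nn_integral_density)
    have "(\<lambda>z. F (case z of (x, X) \<Rightarrow> X(k := x))) \<in> borel_measurable (lborel \<Otimes>\<^sub>M ?R)"
      using measurable_compose[OF m2 meas] by (simp cong: measurable_cong_sets sets_pair_measure_cong)
    from P.P.borel_measurable_nn_integral_fst[OF this]
    show "(\<lambda>u. \<integral>\<^sup>+X. F (X(k := u)) \<partial>?R) \<in> borel_measurable lborel"  by simp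
  qed simp
  also have "\<dots> = (\<integral>\<^sup>+u. ennreal (exp (- (sum r K / r k) * u)) * g (u / r k) * indicator {0..} u \<partial>lborel)"
  proof (rule nn_integral_cong)
    fix u :: real
    have "ennreal (exp (- u)) * ennreal (exp (- (sum r ?J / r k) * u)) = ennreal (exp (- (sum r K / r k) * u))"
      using r[OF K(2)] sum.remove[OF K, of r]
      by (simp add: ennreal_mult'[symmetric] exp_add[symmetric] field_simps)
    moreover have "exponential_density 1 u = (if u < 0 then 0 else exp (- u))"
      by (simp add: exponential_density_def)
    ultimately show "ennreal (exponential_density 1 u) * (\<integral>\<^sup>+X. F (X(k := u)) \<partial>?R)
      = ennreal (exp (- (sum r K / r k) * u)) * g (u / r k) * indicator {0..} u"
      by (cases "u < 0") (simp_all add: inner mult.left_commute[of "ennreal (exp (- u))"] mult.commute[of _ "g (u / r k)"])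
  qed
  \<comment> \<open>Substitution \<open>u = r k * s\<close>, from the standard exponential variable
    to the actual ring time.\<close>
  also have "\<dots> = ennreal \<bar>r k\<bar> * (\<integral>\<^sup>+s. ennreal (exp (- (sum r K / r k) * (0 + r k * s))) * g ((0 + r k * s) / r k) * indicator {0..} (0 + r k * s) \<partial>lborel)"
    using r[OF K(2)] by (intro nn_integral_real_affine) auto
  also have "\<dots> = (\<integral>\<^sup>+s. ennreal \<bar>r k\<bar> * (ennreal (exp (- (sum r K / r k) * (0 + r k * s))) * g ((0 + r k * s) / r k) * indicator {0..} (0 + r k * s)) \<partial>lborel)"
    by (rule nn_integral_cmult[symmetric]) measurable
  also have "\<dots> = (\<integral>\<^sup>+s. ennreal (r k * exp (- sum r K * s)) * g s * indicator {0..} s \<partial>lborel)"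
    using r[OF K(2)] by (intro nn_integral_cong)
      (auto simp: ennreal_mult mult_ac zero_le_mult_iff split: split_indicator)
  finally show ?thesis unfolding F_def .
qed

section \<open>Splitting off the first round of clocks\<close>

lemma exp_clocks_altdef: "exp_clocks = Pi\<^sub>M UNIV (\<lambda>_::nat. clock_space)"
  by (simp add: exp_clocks_def)

lemma prob_space_exp_clocks: "prob_space exp_clocks"
  unfolding exp_clocks_altdef by (intro prob_space_PiM prob_space_clock_space)

lemma measurable_exp_clocks_component: "(\<lambda>\<omega>. \<omega> n) \<in> measurable exp_clocks clock_space"
  unfolding exp_clocks_altdef by (rule measurable_component_singleton) simp

text \<open>The rounds form an i.i.d. sequence, so prepending an independent round does not change
  its law. This is the conditioning on the first round.\<close>

lemma nn_integral_exp_clocks_split: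
  assumes [measurable]: "f \<in> borel_measurable exp_clocks"
  shows "(\<integral>\<^sup>+\<omega>. f \<omega> \<partial>exp_clocks) = (\<integral>\<^sup>+e. (\<integral>\<^sup>+\<omega>. f (case_nat e \<omega>) \<partial>exp_clocks) \<partial>clock_space)"
proof -
  interpret sequence_space "clock_space :: ('a \<Rightarrow> real) measure"
    by (simp add: sequence_space_def product_prob_space_def product_sigma_finite_def
        prob_space_clock_space product_prob_space_axioms_def prob_space_imp_sigma_finite)
  have m: "(\<lambda>(e, \<omega>). case_nat e \<omega>) \<in> measurable (clock_space \<Otimes>\<^sub>M S) S"
    by measurable
  have f: "f \<in> borel_measurable S" using assms by (simp add: exp_clocks_altdef)
  have "(\<integral>\<^sup>+\<omega>. f \<omega> \<partial>S) = (\<integral>\<^sup>+z. f (case z of (e, \<omega>) \<Rightarrow> case_nat e \<omega>) \<partial>(clock_space \<Otimes>\<^sub>M S))"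
    by (subst PiM_iter[symmetric], subst nn_integral_distr[OF m]) (auto intro!: f)
  also have "\<dots> = (\<integral>\<^sup>+e. (\<integral>\<^sup>+\<omega>. f (case_nat e \<omega>) \<partial>S) \<partial>clock_space)"
    using P.nn_integral_fst[of "\<lambda>z. f (case z of (e, \<omega>) \<Rightarrow> case_nat e \<omega>)" clock_space]
      measurable_compose[OF m f] by simp
  finally show ?thesis by (simp add: exp_clocks_altdef)
qed

lemma jump_chain_case_nat:
  "jump_chain rate move x (case_nat e \<omega>) (Suc n) = jump_chain rate move (next_state rate move x e) \<omega> n"
  by (induction n) simp_all

lemma jump_time_case_nat:
  "jump_time rate move x (case_nat e \<omega>) (Suc n)
     = holding_time rate x e + jump_time rate move (next_state rate move x e) \<omega> n"
  unfolding jump_time_def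
  by (subst sum.lessThan_Suc_shift) (simp add: jump_chain_case_nat del: jump_chain.simps(2))

text \<open>The pathwise restart after the first jump. \<open>enn2real\<close> is applied only where
  the holding time is at most \<open>t\<close>, hence finite; an absorbing state has holding time
  \<open>\<infinity>\<close> and falls under the first branch.\<close>

lemma state_at_case_nat:
  assumes "0 \<le> t"
  shows "state_at rate move x (case_nat e \<omega>) t y \<longleftrightarrow>
    (if ennreal t < holding_time rate x e then x = y
     else state_at rate move (next_state rate move x e) \<omega> (t - enn2real (holding_time rate x e)) y)"
proof -
  let ?H = "holding_time rate x e" and ?z = "next_state rate move x e"
  let ?Q = "\<lambda>\<omega> x n t. jump_time rate move x \<omega> n \<le> ennreal t \<and> ennreal t < jump_time rate move x \<omega> (Suc n)
        \<and> jump_chain rate move x \<omega> n = y"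
  have "state_at rate move x (case_nat e \<omega>) t y \<longleftrightarrow> ?Q (case_nat e \<omega>) x 0 t \<or> (\<exists>n. ?Q (case_nat e \<omega>) x (Suc n) t)"
    unfolding state_at_def by (metis not0_implies_Suc)
  also have "?Q (case_nat e \<omega>) x 0 t \<longleftrightarrow> ennreal t < ?H \<and> x = y"
    by (auto simp: jump_time_def)
  also have "(\<exists>n. ?Q (case_nat e \<omega>) x (Suc n) t) \<longleftrightarrow>
     \<not> ennreal t < ?H \<and> state_at rate move ?z \<omega> (t - enn2real ?H) y"
  proof (cases "ennreal t < ?H")
    case True
    have "?H \<le> jump_time rate move x (case_nat e \<omega>) (Suc n)" for n
      by (simp add: jump_time_case_nat)
    then have "\<not> jump_time rate move x (case_nat e \<omega>) (Suc n) \<le> ennreal t" for n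
      using True by (meson leD order_trans)
    then show ?thesis using True by blast
  next
    case False
    then have "?H \<le> ennreal t" by simp
    then obtain h where h: "0 \<le> h" "?H = ennreal h" "h \<le> t"
      using assms by (cases ?H) (auto simp: top_unique)
    have split: "ennreal t = ennreal h + ennreal (t - h)"
      using h by (simp add: ennreal_plus[symmetric])
    have "?Q (case_nat e \<omega>) x (Suc n) t \<longleftrightarrow> ?Q \<omega> ?z n (t - h)" for n
      unfolding jump_time_case_nat jump_chain_case_nat h(2) split
        ennreal_add_left_cancel_le ennreal_add_left_cancel_less by simp
    then show ?thesis using False h unfolding state_at_def by simp
  qed
  finally show ?thesis by auto
qed

section \<open>Invariants and measurability of a chain on a countable state space\<close>

locale clock_chain =
  fixes rate :: "'a \<Rightarrow> 'c \<Rightarrow> real" and move :: "'a \<Rightarrow> 'c \<Rightarrow> 'a" and S :: "'a set"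
  assumes countable_states: "countable S"
    and finite_running: "x \<in> S \<Longrightarrow> finite (running rate x)"
    and move_closed: "x \<in> S \<Longrightarrow> c \<in> running rate x \<Longrightarrow> move x c \<in> S"
begin

lemma next_state_invariant:
  assumes "x \<in> S" "Q x" "\<And>c. c \<in> running rate x \<Longrightarrow> Q (move x c)"
  shows "Q (next_state rate move x e)"
  using assms arg_min_if_finite(1)[OF finite_running[OF assms(1)]]
  unfolding next_state_def by auto

lemma jump_chain_invariant:
  assumes "x \<in> S" "Q x" "\<And>z c. z \<in> S \<Longrightarrow> Q z \<Longrightarrow> c \<in> running rate z \<Longrightarrow> Q (move z c)"
  shows "jump_chain rate move x \<omega> n \<in> S \<and> Q (jump_chain rate move x \<omega> n)"
proof (induction n)
  case (Suc n)
  then show ?case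
    using next_state_invariant[of "jump_chain rate move x \<omega> n" "\<lambda>z. z \<in> S \<and> Q z" "\<omega> n"] assms move_closed
    by auto
qed (use assms in auto)

text \<open>Holds pathwise, since the jump chain stays in \<open>S\<close> and in \<open>Q\<close>.
  With an area bound as \<open>Q\<close> it gives the triangularity of both processes.\<close>

lemma transition_prob_eq_0:
  assumes "x \<in> S" "Q x" "\<And>z c. z \<in> S \<Longrightarrow> Q z \<Longrightarrow> c \<in> running rate z \<Longrightarrow> Q (move z c)"
    and "y \<notin> S \<or> \<not> Q y"
  shows "transition_prob rate move t x y = 0"
proof -
  have "\<not> state_at rate move x \<omega> t y" for \<omega>
    using jump_chain_invariant[OF assms(1-3)] assms(4) unfolding state_at_def by metis
  then show ?thesis by (simp add: transition_prob_def)
qed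

text \<open>In case of ties \<open>arg_min_on\<close> is an unspecified choice among the minimizers.
  Measurability holds because the map factors through the set \<open>?A\<close> of minimizers, which
  takes only finitely many values; any function of such a variable is measurable.\<close>

lemma measurable_next_state:
  assumes x: "x \<in> S"
  shows "next_state rate move x \<in> measurable clock_space (count_space S)"
proof (cases "running rate x = {}")
  case True
  then show ?thesis using x by (simp add: next_state_def[abs_def])
next
  case False
  let ?K = "running rate x"
  let ?A = "\<lambda>e. {k\<in>?K. \<forall>j\<in>?K. \<not> e j / rate x j < e k / rate x k}"
  have fK: "finite ?K" using finite_running[OF x] .
  have [measurable]: "Measurable.pred clock_space (\<lambda>e. \<forall>j\<in>?K. \<not> e j / rate x j < e k / rate x k)" for k
  proof (intro pred_intros_finite fK)
    show "Measurable.pred clock_space (\<lambda>e. \<not> e j / rate x j < e k / rate x k)" for j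
      using measurable_clock[of k] measurable_clock[of j] by measurable
  qed
  have A: "?A \<in> measurable clock_space (count_space (Pow ?K))"
  proof (subst measurable_count_space_eq2)
    show "finite (Pow ?K)" using fK by simp
    have "?A -` {B} \<inter> space clock_space =
      {e\<in>space clock_space. \<forall>k\<in>?K. k \<in> B \<longleftrightarrow> (\<forall>j\<in>?K. \<not> e j / rate x j < e k / rate x k)}" if "B \<subseteq> ?K" for B
      using that by auto
    moreover have "Measurable.pred clock_space (\<lambda>e. \<forall>k\<in>?K. k \<in> B \<longleftrightarrow> (\<forall>j\<in>?K. \<not> e j / rate x j < e k / rate x k))" for B
      by (intro pred_intros_finite fK) measurable
    ultimately show "?A \<in> space clock_space \<rightarrow> Pow ?K \<and>
       (\<forall>B\<in>Pow ?K. ?A -` {B} \<inter> space clock_space \<in> sets clock_space)"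
      by auto
  qed
  have "(\<lambda>e. move x (SOME k. k \<in> ?A e)) \<in> measurable clock_space (count_space UNIV)"
    by (rule measurable_compose[OF A]) simp
  also have "(\<lambda>e. move x (SOME k. k \<in> ?A e)) = next_state rate move x"
    using False by (auto simp: next_state_def fun_eq_iff arg_min_on_def arg_min_def is_arg_min_def intro!: arg_cong[of _ _ "move x"] arg_cong[of _ _ Eps])
  finally have "next_state rate move x \<in> measurable clock_space (count_space UNIV)" .
  then show ?thesis
    using next_state_invariant[OF x, of "\<lambda>z. z \<in> S"] move_closed x
    by (auto simp: measurable_def)
qed

lemma measurable_holding_time:
  assumes x: "x \<in> S"
  shows "holding_time rate x \<in> borel_measurable clock_space"
  unfolding holding_time_def[abs_def]
proof (rule borel_measurable_INF)
  show "countable (running rate x)" using finite_running[OF x] by (rule countable_finite)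
  show "(\<lambda>e. ennreal (e c / rate x c)) \<in> borel_measurable clock_space" for c
    using measurable_clock[of c] by measurable
qed

lemma measurable_jump_chain:
  assumes x: "x \<in> S"
  shows "(\<lambda>\<omega>. jump_chain rate move x \<omega> n) \<in> measurable exp_clocks (count_space S)"
proof (induction n)
  case (Suc n)
  have "(\<lambda>\<omega>. next_state rate move (jump_chain rate move x \<omega> n) (\<omega> n)) \<in> measurable exp_clocks (count_space S)"
    by (rule measurable_compose_countable'[OF _ Suc countable_states])
      (rule measurable_compose[OF measurable_exp_clocks_component measurable_next_state])
  then show ?case by simp
qed (use x in simp)

lemma measurable_jump_time:
  assumes x: "x \<in> S"
  shows "(\<lambda>\<omega>. jump_time rate move x \<omega> n) \<in> borel_measurable exp_clocks"
  unfolding jump_time_def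
proof (rule borel_measurable_sum)
  show "(\<lambda>\<omega>. holding_time rate (jump_chain rate move x \<omega> i) (\<omega> i)) \<in> borel_measurable exp_clocks" for i
    by (rule measurable_compose_countable'[OF _ measurable_jump_chain[OF x] countable_states])
      (rule measurable_compose[OF measurable_exp_clocks_component measurable_holding_time])
qed

text \<open>Joint measurability in time and randomness makes the transition probability measurable
  in time, as is required for integrating it over the time of the first jump.\<close>

lemma measurable_state_at:
  assumes x: "x \<in> S"
  shows "Measurable.pred (borel \<Otimes>\<^sub>M exp_clocks) (\<lambda>(t, \<omega>). state_at rate move x \<omega> t y)"
proof -
  note [measurable] = measurable_jump_time[OF x]
  have [measurable]: "Measurable.pred exp_clocks (\<lambda>\<omega>. jump_chain rate move x \<omega> n = y)" for n
    by (rule measurable_compose[OF measurable_jump_chain[OF x]]) simp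
  show ?thesis unfolding state_at_def split_beta' by measurable
qed

lemma measurable_state_at_fixed:
  assumes x: "x \<in> S"
  shows "Measurable.pred exp_clocks (\<lambda>\<omega>. state_at rate move x \<omega> t y)"
  using measurable_Pair2[OF measurable_state_at[OF x, of y], of t] by simp

lemma ennreal_transition_prob:
  assumes x: "x \<in> S"
  shows "ennreal (transition_prob rate move t x y) = (\<integral>\<^sup>+\<omega>. of_bool (state_at rate move x \<omega> t y) \<partial>exp_clocks)"
proof -
  interpret prob_space exp_clocks by (rule prob_space_exp_clocks)
  note [measurable] = measurable_state_at_fixed[OF x]
  have "(\<integral>\<^sup>+\<omega>. of_bool (state_at rate move x \<omega> t y) \<partial>exp_clocks) =
    (\<integral>\<^sup>+\<omega>. indicator {\<omega>\<in>space exp_clocks. state_at rate move x \<omega> t y} \<omega> \<partial>exp_clocks)"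
    by (intro nn_integral_cong) (auto split: split_indicator)
  then show ?thesis by (simp add: transition_prob_def emeasure_eq_measure)
qed

lemma transition_prob_nonneg: "0 \<le> transition_prob rate move t x y"
  by (simp add: transition_prob_def)

lemma transition_prob_le_1: "transition_prob rate move t x y \<le> 1"
  unfolding transition_prob_def by (rule prob_space.prob_le_1[OF prob_space_exp_clocks])

lemma measurable_transition_prob[measurable]:
  assumes x: "x \<in> S"
  shows "(\<lambda>t. transition_prob rate move t x y) \<in> borel_measurable borel"
proof -
  interpret prob_space exp_clocks by (rule prob_space_exp_clocks)
  note [measurable] = measurable_state_at[OF x]
  have "(\<lambda>t. enn2real (\<integral>\<^sup>+\<omega>. of_bool (state_at rate move x \<omega> t y) \<partial>exp_clocks)) \<in> borel_measurable borel"
    by measurable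
  then show ?thesis
    by (simp add: ennreal_transition_prob[OF x, symmetric] transition_prob_nonneg)
qed

end

section \<open>First-step analysis\<close>

context clock_chain
begin

definition total_rate :: "'a \<Rightarrow> real" where
  "total_rate x = sum (rate x) (running rate x)"

text \<open>
  Ties between clocks need no separate treatment: the probabilities that a given clock rings
  strictly first, as computed by \<open>first_ring\<close>, already add up to 1.
\<close>

lemma nn_integral_first_jump:
  assumes x: "x \<in> S" and ne: "running rate x \<noteq> {}"
    and G: "\<And>z. z \<in> S \<Longrightarrow> (\<lambda>s. G (ennreal s) z) \<in> borel_measurable borel"
  shows "(\<integral>\<^sup>+e. G (holding_time rate x e) (next_state rate move x e) \<partial>clock_space) =
    (\<integral>\<^sup>+s. (\<Sum>k\<in>running rate x. ennreal (rate x k * exp (- total_rate x * s)) * G (ennreal s) (move x k))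
       * indicator {0..} s \<partial>lborel)"
proof -
  let ?K = "running rate x" and ?r = "rate x"
  let ?A = "\<lambda>e k. \<forall>j\<in>?K - {k}. e k / ?r k < e j / ?r j"
  have fK: "finite ?K" using finite_running[OF x] .
  have r: "?r k > 0" if "k \<in> ?K" for k using that by (simp add: running_def)
  have c: "total_rate x > 0" unfolding total_rate_def using fK ne r by (intro sum_pos) auto
  have [measurable]: "Measurable.pred clock_space (\<lambda>e. ?A e k)" for k
  proof (rule pred_intros_finite)
    show "Measurable.pred clock_space (\<lambda>e. e k / ?r k < e j / ?r j)" for j
      using measurable_clock[of k] measurable_clock[of j] by measurable
  qed (use fK in simp)
  \<comment> \<open>Used twice: with the constant 1 for the almost sure existence of a strictly
    first clock, and with \<open>G\<close> for the integral itself.\<close>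
  have sum_rings: "(\<Sum>k\<in>?K. \<integral>\<^sup>+e. (if ?A e k then g k (e k / ?r k) else 0) \<partial>clock_space) =
    (\<integral>\<^sup>+s. (\<Sum>k\<in>?K. ennreal (?r k * exp (- total_rate x * s)) * g k s) * indicator {0..} s \<partial>lborel)"
    if "\<And>k. k \<in> ?K \<Longrightarrow> g k \<in> borel_measurable borel" for g :: "_ \<Rightarrow> real \<Rightarrow> ennreal"
  proof -
    have "(\<Sum>k\<in>?K. \<integral>\<^sup>+e. (if ?A e k then g k (e k / ?r k) else 0) \<partial>clock_space) =
      (\<Sum>k\<in>?K. \<integral>\<^sup>+s. ennreal (?r k * exp (- total_rate x * s)) * g k s * indicator {0..} s \<partial>lborel)"
      unfolding total_rate_def using that by (intro sum.cong refl first_ring fK r) auto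
    also have "\<dots> = (\<integral>\<^sup>+s. (\<Sum>k\<in>?K. ennreal (?r k * exp (- total_rate x * s)) * g k s * indicator {0..} s) \<partial>lborel)"
      by (rule nn_integral_sum[symmetric]) (use that in measurable)
    finally show ?thesis by (simp add: sum_distrib_right)
  qed
  have unique: "k = k'" if "k \<in> ?K" "k' \<in> ?K" "?A e k" "?A e k'" for k k' e
  proof (rule ccontr)
    assume "k \<noteq> k'"
    then have "e k / ?r k < e k' / ?r k'" "e k' / ?r k' < e k / ?r k" using that by blast+
    then show False by simp
  qed
  have pick: "(\<Sum>k'\<in>?K. if ?A e k' then f k' else 0) = f k"
    if "k \<in> ?K" "?A e k" for k e and f :: "'c \<Rightarrow> ennreal"
  proof -
    have "?A e k' \<longleftrightarrow> k' = k" if "k' \<in> ?K" for k'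
      using unique[OF that \<open>k \<in> ?K\<close> _ \<open>?A e k\<close>] \<open>?A e k\<close> by blast
    then have "(\<Sum>k'\<in>?K. if ?A e k' then f k' else 0) = (\<Sum>k'\<in>?K. if k' = k then f k' else 0)"
      by (intro sum.cong refl if_cong)
    then show ?thesis using \<open>k \<in> ?K\<close> fK by simp
  qed
  have "AE e in clock_space. \<exists>k\<in>?K. ?A e k"
  proof -
    interpret prob_space "clock_space :: ('c \<Rightarrow> real) measure" by (rule prob_space_clock_space)
    have "emeasure clock_space {e\<in>space clock_space. \<exists>k\<in>?K. ?A e k} =
       (\<integral>\<^sup>+e. indicator {e\<in>space clock_space. \<exists>k\<in>?K. ?A e k} e \<partial>clock_space)"
      by (rule nn_integral_indicator[symmetric]) (use fK in \<open>auto intro!: sets.sets_Collect_finite_Ex\<close>)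
    also have "\<dots> = (\<integral>\<^sup>+e. (\<Sum>k\<in>?K. if ?A e k then 1 else 0) \<partial>clock_space)"
    proof (intro nn_integral_cong)
      fix e :: "'c \<Rightarrow> real" assume e: "e \<in> space clock_space"
      show "indicator {e\<in>space clock_space. \<exists>k\<in>?K. ?A e k} e = (\<Sum>k\<in>?K. if ?A e k then 1 else (0::ennreal))"
      proof (cases "\<exists>k\<in>?K. ?A e k")
        case True
        then obtain k where k: "k \<in> ?K" "?A e k" by blast
        have "e \<in> {e\<in>space clock_space. \<exists>k\<in>?K. ?A e k}" using e True by blast
        then show ?thesis using pick[OF k, of "\<lambda>_. 1"] by (simp only: indicator_simps)
      next
        case False
        then have "(\<Sum>k\<in>?K. if ?A e k then 1 else (0::ennreal)) = 0"
          by (intro sum.neutral ballI if_not_P) blast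
        moreover have "e \<notin> {e\<in>space clock_space. \<exists>k\<in>?K. ?A e k}" using False by blast
        ultimately show ?thesis by (simp only: indicator_simps simp_thms)
      qed
    qed
    also have "\<dots> = (\<Sum>k\<in>?K. \<integral>\<^sup>+e. (if ?A e k then 1 else 0) \<partial>clock_space)"
      by (rule nn_integral_sum) measurable
    also have "\<dots> = (\<integral>\<^sup>+s. (\<Sum>k\<in>?K. ennreal (?r k * exp (- total_rate x * s)) * 1) * indicator {0..} s \<partial>lborel)"
      by (rule sum_rings) auto
    also have "\<dots> = (\<integral>\<^sup>+s. ennreal (exponential_density (total_rate x) s) * indicator UNIV s \<partial>lborel)"
      using r by (intro nn_integral_cong)
        (auto simp: exponential_density_def sum_ennreal less_imp_le sum_distrib_right[symmetric] total_rate_def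
          mult.commute split: split_indicator)
    also have "\<dots> = emeasure (density lborel (exponential_density (total_rate x))) UNIV"
      by (rule emeasure_density[symmetric]) auto
    also have "\<dots> = 1"
      using prob_space.emeasure_space_1[OF prob_space_exponential_density[OF c]] by simp
    finally show ?thesis
      by (simp add: emeasure_eq_measure prob_Collect_eq_1 fK sets.sets_Collect_finite_Ex)
  qed
  then have "(\<integral>\<^sup>+e. G (holding_time rate x e) (next_state rate move x e) \<partial>clock_space) =
    (\<integral>\<^sup>+e. (\<Sum>k\<in>?K. if ?A e k then G (ennreal (e k / ?r k)) (move x k) else 0) \<partial>clock_space)"
  proof (intro nn_integral_cong_AE, elim AE_mp, intro AE_I2 impI)
    fix e assume "\<exists>k\<in>?K. ?A e k"
    then obtain k where k: "k \<in> ?K" "?A e k" by blast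
    have "is_arg_min (\<lambda>c. e c / ?r c) (\<lambda>c. c \<in> ?K) c \<longleftrightarrow> c = k" for c
    proof (cases "c = k")
      case True
      have "\<not> e j / ?r j < e k / ?r k" if "j \<in> ?K" for j
        using k that by (cases "j = k") (auto dest: less_asym)
      then show ?thesis using True k by (auto simp: is_arg_min_def)
    next
      case False
      then show ?thesis using k by (auto simp: is_arg_min_def)
    qed
    then have n: "next_state rate move x e = move x k"
      using ne by (simp add: next_state_def arg_min_on_def arg_min_def)
    have "e k / ?r k \<le> e j / ?r j" if "j \<in> ?K" for j
      using k that by (cases "j = k") (auto simp: less_imp_le)
    then have h: "holding_time rate x e = ennreal (e k / ?r k)"
      unfolding holding_time_def using k
      by (intro antisym INF_lower INF_greatest) (auto intro: ennreal_leI)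
    show "G (holding_time rate x e) (next_state rate move x e) =
       (\<Sum>k\<in>?K. if ?A e k then G (ennreal (e k / ?r k)) (move x k) else 0)"
      unfolding n h by (rule pick[OF k, symmetric])
  qed
  also have "\<dots> = (\<Sum>k\<in>?K. \<integral>\<^sup>+e. (if ?A e k then G (ennreal (e k / ?r k)) (move x k) else 0) \<partial>clock_space)"
  proof (rule nn_integral_sum)
    fix k assume "k \<in> ?K"
    from G[OF move_closed[OF x this]]
    have "(\<lambda>e. G (ennreal (e k / ?r k)) (move x k)) \<in> borel_measurable clock_space"
      by (rule measurable_compose[rotated]) (use measurable_clock[of k] in measurable)
    then show "(\<lambda>e. if ?A e k then G (ennreal (e k / ?r k)) (move x k) else 0) \<in> borel_measurable clock_space"
      by measurable
  qed
  also have "\<dots> = (\<integral>\<^sup>+s. (\<Sum>k\<in>?K. ennreal (?r k * exp (- total_rate x * s)) * G (ennreal s) (move x k))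
       * indicator {0..} s \<partial>lborel)"
    by (rule sum_rings) (rule G[OF move_closed[OF x]])
  finally show ?thesis .
qed

lemma transition_prob_first_step:
  assumes x: "x \<in> S" and t: "0 \<le> t"
  shows "ennreal (transition_prob rate move t x y) =
    (\<integral>\<^sup>+e. (if ennreal t < holding_time rate x e then of_bool (x = y)
       else ennreal (transition_prob rate move (t - enn2real (holding_time rate x e)) (next_state rate move x e) y))
      \<partial>clock_space)"
proof -
  have [measurable]: "(\<lambda>\<omega>. of_bool (state_at rate move x \<omega> t y) :: ennreal) \<in> borel_measurable exp_clocks"
    using measurable_state_at_fixed[OF x] by measurable
  have "ennreal (transition_prob rate move t x y) =
    (\<integral>\<^sup>+e. (\<integral>\<^sup>+\<omega>. of_bool (state_at rate move x (case_nat e \<omega>) t y) \<partial>exp_clocks) \<partial>clock_space)"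
    unfolding ennreal_transition_prob[OF x] by (rule nn_integral_exp_clocks_split) measurable
  also have "\<dots> = (\<integral>\<^sup>+e. (if ennreal t < holding_time rate x e then of_bool (x = y)
       else ennreal (transition_prob rate move (t - enn2real (holding_time rate x e)) (next_state rate move x e) y))
      \<partial>clock_space)"
  proof (rule nn_integral_cong)
    fix e :: "'c \<Rightarrow> real"
    interpret prob_space "exp_clocks :: (nat \<Rightarrow> 'c \<Rightarrow> real) measure" by (rule prob_space_exp_clocks)
    have "next_state rate move x e \<in> S"
      using next_state_invariant[OF x, of "\<lambda>z. z \<in> S"] move_closed x by auto
    then show "(\<integral>\<^sup>+\<omega>. of_bool (state_at rate move x (case_nat e \<omega>) t y) \<partial>exp_clocks) =
      (if ennreal t < holding_time rate x e then of_bool (x = y)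
       else ennreal (transition_prob rate move (t - enn2real (holding_time rate x e)) (next_state rate move x e) y))"
      by (simp add: state_at_case_nat[OF t] ennreal_transition_prob emeasure_space_1)
  qed
  finally show ?thesis .
qed

lemma transition_prob_absorbing:
  assumes x: "x \<in> S" and t: "0 \<le> t" and "running rate x = {}"
  shows "transition_prob rate move t x y = of_bool (x = y)"
proof -
  interpret prob_space "clock_space :: ('c \<Rightarrow> real) measure" by (rule prob_space_clock_space)
  have "holding_time rate x e = \<top>" for e using assms by (simp add: holding_time_def)
  then have "ennreal (transition_prob rate move t x y) = ennreal (of_bool (x = y))"
    using transition_prob_first_step[OF x t, of y] by (cases "x = y") (simp_all add: emeasure_space_1)
  then show ?thesis by (subst (asm) ennreal_inj) (auto simp: transition_prob_nonneg)
qed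

text \<open>Either no clock rings up to time \<open>t\<close>, which has probability
  \<open>exp (- total_rate x * t)\<close>, or the first jump happens at time \<open>t - u\<close>
  and leaves the remaining time \<open>u\<close> to the chain started afresh. With \<open>u\<close>
  as variable, the transition probabilities inside the integral do not depend on
  \<open>t\<close>.\<close>

lemma transition_prob_backward_nn_integral:
  assumes x: "x \<in> S" and t: "0 \<le> t" and ne: "running rate x \<noteq> {}"
  shows "ennreal (transition_prob rate move t x y) =
    ennreal (of_bool (x = y) * exp (- total_rate x * t)) +
    (\<integral>\<^sup>+u. ennreal (\<Sum>k\<in>running rate x. rate x k * exp (- total_rate x * (t - u)) * transition_prob rate move u (move x k) y)
       * indicator {0..t} u \<partial>lborel)"
proof -
  let ?K = "running rate x" and ?r = "rate x" and ?P = "transition_prob rate move"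
  have fK: "finite ?K" using finite_running[OF x] .
  have r: "?r k > 0" if "k \<in> ?K" for k using that by (simp add: running_def)
  have c: "total_rate x > 0" unfolding total_rate_def using fK ne r by (intro sum_pos) auto
  define D where "D = (\<lambda>s. exponential_density (total_rate x) s)"
  define J where "J = (\<lambda>s. \<Sum>k\<in>?K. ?r k * exp (- total_rate x * s) * ?P (t - s) (move x k) y)"
  have J0: "0 \<le> J s" for s
    unfolding J_def using r by (intro sum_nonneg mult_nonneg_nonneg) (auto simp: less_imp_le transition_prob_nonneg)
  have [measurable]: "(\<lambda>s. ?P s (move x k) y) \<in> borel_measurable borel" if "k \<in> ?K" for k
    by (rule measurable_transition_prob[OF move_closed[OF x that]])
  have [measurable]: "J \<in> borel_measurable borel" unfolding J_def by measurable
  have [measurable]: "D \<in> borel_measurable borel" unfolding D_def by measurable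
  let ?G = "\<lambda>h z. if ennreal t < h then of_bool (x = y) else ennreal (?P (t - enn2real h) z y)"
  have "ennreal (?P t x y) = (\<integral>\<^sup>+s. (\<Sum>k\<in>?K. ennreal (?r k * exp (- total_rate x * s)) * ?G (ennreal s) (move x k))
       * indicator {0..} s \<partial>lborel)"
    unfolding transition_prob_first_step[OF x t]
    by (rule nn_integral_first_jump[OF x ne]) (use measurable_transition_prob in measurable)
  also have "\<dots> = (\<integral>\<^sup>+s. of_bool (x = y) * (ennreal (D s) * indicator {t<..} s) + ennreal (J s) * indicator {0..t} s \<partial>lborel)"
  proof (rule nn_integral_cong)
    fix s :: real
    consider "s < 0" | "0 \<le> s" "s \<le> t" | "t < s" using t by linarith
    then show "(\<Sum>k\<in>?K. ennreal (?r k * exp (- total_rate x * s)) * ?G (ennreal s) (move x k)) * indicator {0..} s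
       = of_bool (x = y) * (ennreal (D s) * indicator {t<..} s) + ennreal (J s) * indicator {0..t} s"
    proof cases
      case 2
      then have "\<not> ennreal t < ennreal s" by (simp add: ennreal_less_iff)
      have "(\<Sum>k\<in>?K. ennreal (?r k * exp (- total_rate x * s)) * ennreal (?P (t - s) (move x k) y)) = ennreal (J s)"
        unfolding J_def using r
        by (subst sum_ennreal[symmetric]) (auto simp: less_imp_le transition_prob_nonneg ennreal_mult intro!: sum.cong)
      with 2 \<open>\<not> ennreal t < ennreal s\<close> show ?thesis by simp
    next
      case 3
      then have "ennreal t < ennreal s" using t by (simp add: ennreal_less_iff)
      moreover have "(\<Sum>k\<in>?K. ennreal (?r k * exp (- total_rate x * s))) = ennreal (D s)"
        using 3 t r by (subst sum_ennreal) (auto simp: less_imp_le D_def exponential_density_def total_rate_def sum_distrib_right[symmetric] mult.commute)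
      ultimately show ?thesis using 3 t by (cases "x = y") (simp_all add: mult.commute)
    qed (use t in auto)
  qed
  also have "\<dots> = of_bool (x = y) * (\<integral>\<^sup>+s. ennreal (D s) * indicator {t<..} s \<partial>lborel) + (\<integral>\<^sup>+s. ennreal (J s) * indicator {0..t} s \<partial>lborel)"
    by (subst nn_integral_add) (auto simp: nn_integral_cmult)
  also have "(\<integral>\<^sup>+s. ennreal (D s) * indicator {t<..} s \<partial>lborel) = emeasure (density lborel D) {t<..}"
    by (rule emeasure_density[symmetric]) auto
  also have "\<dots> = ennreal (exp (- total_rate x * t))"
  proof -
    interpret prob_space "density lborel D" unfolding D_def by (rule prob_space_exponential_density[OF c])
    have "distributed (density lborel D) lborel (\<lambda>x. x) (exponential_density (total_rate x))"
      unfolding distributed_def D_def by (auto simp: distr_id2 intro!: distr_id2)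
    from exponential_distributedD_gt[OF this t c] show ?thesis
      by (simp add: emeasure_eq_measure greaterThan_def mult.commute)
  qed
  \<comment> \<open>Substitution from the jump time \<open>s\<close> to the remaining time
    \<open>u = t - s\<close>.\<close>
  also have "(\<integral>\<^sup>+s. ennreal (J s) * indicator {0..t} s \<partial>lborel) = (\<integral>\<^sup>+u. ennreal (J (t - u)) * indicator {0..t} u \<partial>lborel)"
    by (subst nn_integral_real_affine[where c = "-1" and t = t])
      (auto intro!: nn_integral_cong split: split_indicator)
  finally show ?thesis by (simp add: J_def)
qed

end

section \<open>Generators and the backward equation\<close>

definition generator :: "('a \<Rightarrow> 'c \<Rightarrow> real) \<Rightarrow> ('a \<Rightarrow> 'c \<Rightarrow> 'a) \<Rightarrow> ('a \<Rightarrow> real) \<Rightarrow> 'a \<Rightarrow> real" where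
  "generator rate move f x = (\<Sum>c\<in>running rate x. rate x c * (f (move x c) - f x))"

lemma generator_cong:
  assumes "f x = g x" "\<And>c. c \<in> running rate x \<Longrightarrow> f (move x c) = g (move x c)"
  shows "generator rate move f x = generator rate move g x"
  unfolding generator_def using assms by (intro sum.cong) auto

lemma generator_const: "generator rate move (\<lambda>_. a) x = 0"
  by (simp add: generator_def)

lemma generator_diff: "generator rate move (\<lambda>z. f z - g z) x = generator rate move f x - generator rate move g x"
  by (simp add: generator_def sum_subtractf[symmetric] algebra_simps)

lemma generator_cmult: "generator rate move (\<lambda>z. a * f z) x = a * generator rate move f x"
  by (simp add: generator_def sum_distrib_left algebra_simps)

lemma generator_sum: "generator rate move (\<lambda>z. \<Sum>i\<in>I. F i z) x = (\<Sum>i\<in>I. generator rate move (F i) x)"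
  unfolding generator_def sum_subtractf[symmetric] sum_distrib_left by (rule sum.swap)

lemma has_real_derivative_generator:
  assumes "((\<lambda>t. F t x) has_real_derivative F' x) (at t within A)"
    and "\<And>c. c \<in> running rate x \<Longrightarrow> ((\<lambda>t. F t (move x c)) has_real_derivative F' (move x c)) (at t within A)"
  shows "((\<lambda>t. generator rate move (F t) x) has_real_derivative generator rate move F' x) (at t within A)"
  unfolding generator_def using assms by (intro DERIV_sum DERIV_cmult DERIV_diff) auto

lemma has_real_derivative_exp_mult:
  assumes "(f has_real_derivative f') (at t within A)"
  shows "((\<lambda>t. exp (c * t) * f t) has_real_derivative exp (c * t) * (f' + c * f t)) (at t within A)"
  by (rule derivative_eq_intros assms refl | simp add: algebra_simps)+

context clock_chain
begin

text \<open>Since \<open>exp (- total_rate x * (t - u))\<close> factors, \<open>t\<close> survives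
  only in a prefactor and as the upper limit of the integral, the form to which the fundamental
  theorem of calculus applies. Integrability is clear because \<open>f\<close> is measurable and
  bounded on \<open>{0..t}\<close>.\<close>

lemma transition_prob_backward_integral:
  fixes y assumes x: "x \<in> S" and t: "0 \<le> t" and ne: "running rate x \<noteq> {}"
  defines "f \<equiv> \<lambda>u. exp (total_rate x * u) * (\<Sum>k\<in>running rate x. rate x k * transition_prob rate move u (move x k) y)"
  shows "f integrable_on {0..t}"
    and "transition_prob rate move t x y = exp (- total_rate x * t) * (of_bool (x = y) + integral {0..t} f)"
proof -
  let ?K = "running rate x" and ?P = "transition_prob rate move"
  define h where "h = (\<lambda>u. \<Sum>k\<in>?K. rate x k * ?P u (move x k) y)"
  have r: "rate x k > 0" if "k \<in> ?K" for k using that by (simp add: running_def)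
  have c: "0 \<le> total_rate x" unfolding total_rate_def using r by (intro sum_nonneg) (auto simp: less_imp_le)
  have h0: "0 \<le> h u" for u
    unfolding h_def using r by (intro sum_nonneg mult_nonneg_nonneg) (auto simp: less_imp_le transition_prob_nonneg)
  have h1: "h u \<le> total_rate x" for u
    unfolding h_def total_rate_def using r
    by (intro sum_mono mult_left_le) (auto simp: less_imp_le transition_prob_le_1)
  have [measurable]: "(\<lambda>s. ?P s (move x k) y) \<in> borel_measurable borel" if "k \<in> ?K" for k
    by (rule measurable_transition_prob[OF move_closed[OF x that]])
  have [measurable]: "h \<in> borel_measurable borel" unfolding h_def by measurable
  have f: "f = (\<lambda>u. exp (total_rate x * u) * h u)" by (simp add: f_def h_def)
  have [measurable]: "f \<in> borel_measurable borel" unfolding f by measurable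
  have f0: "0 \<le> f u" for u using h0 by (simp add: f)
  have "set_integrable lborel {0..t} f"
    unfolding set_integrable_def
  proof (rule integrableI_bounded_set_indicator)
    have "f u \<le> exp (total_rate x * t) * total_rate x" if "u \<in> {0..t}" for u
      unfolding f using that c h0 h1 by (intro mult_mono) (auto intro: mult_left_mono)
    then show "AE u in lborel. u \<in> {0..t} \<longrightarrow> norm (f u) \<le> exp (total_rate x * t) * total_rate x"
      using f0 by auto
  qed (auto simp: emeasure_lborel_Icc_eq)
  then show int: "f integrable_on {0..t}"
    by (rule set_borel_integral_eq_integral)
  let ?e = "exp (- total_rate x * t)"
  have g: "((\<lambda>u. ?e * f u) has_integral ?e * integral {0..t} f) {0..t}"
    by (rule has_integral_mult_right) (rule integrable_integral[OF int])
  have I0: "0 \<le> integral {0..t} f" by (intro integral_nonneg int f0)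
  have shift: "exp (- total_rate x * (t - u)) = ?e * exp (total_rate x * u)" for u
    by (simp add: exp_add[symmetric] algebra_simps)
  have "(\<Sum>k\<in>?K. rate x k * exp (- total_rate x * (t - u)) * ?P u (move x k) y) = ?e * f u" for u
    unfolding f h_def shift sum_distrib_left by (simp add: mult_ac)
  then have "ennreal (?P t x y) = ennreal (of_bool (x = y) * ?e) + (\<integral>\<^sup>+u. ennreal (?e * f u) * indicator {0..t} u \<partial>lborel)"
    unfolding transition_prob_backward_nn_integral[OF x t ne] by simp
  also have "(\<integral>\<^sup>+u. ennreal (?e * f u) * indicator {0..t} u \<partial>lborel) = (\<integral>\<^sup>+u. ennreal (indicator {0..t} u * (?e * f u)) \<partial>lborel)"
    by (intro nn_integral_cong) (auto split: split_indicator)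
  also have "\<dots> = ennreal (?e * integral {0..t} f)"
    by (rule nn_integral_has_integral_lebesgue[OF _ g]) (use f0 in auto)
  finally have "ennreal (?P t x y) = ennreal (of_bool (x = y) * ?e + ?e * integral {0..t} f)"
    using I0 by (simp add: ennreal_plus)
  then show "?P t x y = ?e * (of_bool (x = y) + integral {0..t} f)"
    using I0 by (subst (asm) ennreal_inj) (auto simp: transition_prob_nonneg algebra_simps)
qed

lemma transition_prob_0:
  assumes x: "x \<in> S"
  shows "transition_prob rate move 0 x y = of_bool (x = y)"
  using transition_prob_absorbing[OF x, of 0] transition_prob_backward_integral(2)[OF x, of 0]
  by (cases "running rate x = {}") auto

text \<open>The integral equation improves regularity: a bounded measurable integrand gives
  continuity here, and a continuous integrand then gives differentiability in
  \<open>transition_prob_backward\<close>.\<close>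

lemma continuous_on_transition_prob:
  assumes x: "x \<in> S"
  shows "continuous_on {0..T} (\<lambda>t. transition_prob rate move t x y)"
proof (cases "running rate x = {} \<or> T < 0")
  case True
  have "continuous_on {0..T} (\<lambda>t. of_bool (x = y) :: real)" by simp
  then show ?thesis
    by (rule continuous_on_eq) (use True in \<open>auto simp: transition_prob_absorbing[OF x]\<close>)
next
  case False
  then have ne: "running rate x \<noteq> {}" and T: "0 \<le> T" by auto
  let ?f = "\<lambda>u. exp (total_rate x * u) * (\<Sum>k\<in>running rate x. rate x k * transition_prob rate move u (move x k) y)"
  have "continuous_on {0..T} (\<lambda>t. exp (- total_rate x * t) * (of_bool (x = y) + integral {0..t} ?f))"
    by (intro continuous_intros indefinite_integral_continuous_1 transition_prob_backward_integral(1) x T ne)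
  then show ?thesis
    by (rule continuous_on_eq) (simp add: transition_prob_backward_integral(2)[OF x _ ne])
qed

theorem transition_prob_backward:
  assumes x: "x \<in> S" and t: "0 \<le> t"
  shows "((\<lambda>t. transition_prob rate move t x y) has_real_derivative
    generator rate move (\<lambda>z. transition_prob rate move t z y) x) (at t within {0..})"
proof (cases "running rate x = {}")
  case True
  have "((\<lambda>t. of_bool (x = y)) has_real_derivative 0) (at t within {0..})" by simp
  then have "((\<lambda>t. transition_prob rate move t x y) has_real_derivative 0) (at t within {0..})"
    by (rule has_field_derivative_transform_within[where d = 1])
      (use t True transition_prob_absorbing[OF x] in auto)
  then show ?thesis using True by (simp add: generator_def)
next
  case ne: False
  let ?P = "transition_prob rate move" and ?K = "running rate x"
  let ?h = "\<lambda>u. \<Sum>k\<in>?K. rate x k * ?P u (move x k) y"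
  let ?f = "\<lambda>u. exp (total_rate x * u) * ?h u"
  have "continuous_on {0..t + 1} ?f"
    by (intro continuous_intros continuous_on_transition_prob move_closed x)
  then have "((\<lambda>t. integral {0..t} ?f) has_real_derivative ?f t) (at t within {0..t + 1})"
    using t by (intro integral_has_real_derivative) auto
  \<comment> \<open>The end point \<open>t + 1\<close> only provides room to the right of
    \<open>t\<close>; what remains is the one-sided derivative at 0.\<close>
  also have "at t within {0..t + 1} = at t within {0..}"
    by (rule at_within_nhd[where S = "{..<t + 1}"]) auto
  finally have "((\<lambda>t. of_bool (x = y) + integral {0..t} ?f) has_real_derivative ?f t) (at t within {0..})"
    by (auto intro!: derivative_eq_intros)
  from has_real_derivative_exp_mult[OF this, of "- total_rate x"]
  have "((\<lambda>t. exp (- total_rate x * t) * (of_bool (x = y) + integral {0..t} ?f)) has_real_derivative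
     ?h t - total_rate x * (exp (- total_rate x * t) * (of_bool (x = y) + integral {0..t} ?f))) (at t within {0..})"
    by (rule DERIV_cong) (simp add: algebra_simps exp_minus field_simps)
  then have "((\<lambda>t. exp (- total_rate x * t) * (of_bool (x = y) + integral {0..t} ?f)) has_real_derivative
     generator rate move (\<lambda>z. ?P t z y) x) (at t within {0..})"
    by (simp add: generator_def total_rate_def right_diff_distrib sum_subtractf sum_distrib_right
        transition_prob_backward_integral(2)[OF x t ne])
  then show ?thesis
    by (rule has_field_derivative_transform_within[where d = 1])
      (use t in \<open>auto simp: transition_prob_backward_integral(2)[OF x _ ne]\<close>)
qed

end

section \<open>Configurations and their area\<close>

lemma configsE:
  assumes "x \<in> configs"
  obtains X :: "nat \<Rightarrow> int" and N0 where "x = X ` {1..}" "\<And>i. i \<ge> 1 \<Longrightarrow> X (Suc i) < X i"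
    "\<And>i j. 1 \<le> i \<Longrightarrow> i < j \<Longrightarrow> X j < X i" "inj_on X {1..}" "\<And>N. N \<ge> N0 \<Longrightarrow> X N = - int N"
proof -
  from assms obtain X :: "nat \<Rightarrow> int" where X: "x = X ` {1..}" "\<And>i. i \<ge> 1 \<Longrightarrow> X (Suc i) < X i"
    "\<forall>\<^sub>F N in sequentially. X N = - int N"
    unfolding configs_def by auto
  have dec: "X j < X i" if "i < j" "1 \<le> i" for i j
    using that
  proof (induction j)
    case (Suc j)
    then show ?case using X(2)[of j] by (cases "i = j") auto
  qed simp
  have "inj_on X {1..}"
    by (rule linorder_inj_onI) (use dec in \<open>fastforce+\<close>)
  with X dec show thesis using that unfolding eventually_sequentially by blast
qed

lemma configs_bounded:
  assumes "x \<in> configs"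
  obtains M where "0 \<le> M" "\<forall>p\<in>x. p \<le> M" "\<forall>p. p \<notin> x \<longrightarrow> - M \<le> p"
proof -
  from configsE[OF assms] obtain X N0 where X: "x = X ` {1..}"
    "\<And>i j. 1 \<le> i \<Longrightarrow> i < j \<Longrightarrow> X j < X i" "\<And>N. N \<ge> N0 \<Longrightarrow> X N = - int N" by metis
  let ?M = "max (int N0) \<bar>X 1\<bar>"
  have "p \<in> x" if "p < - ?M" for p
  proof -
    have "p = X (nat (- p))" using that X(3)[of "nat (- p)"] by simp
    then show ?thesis unfolding X(1) using that by (intro rev_image_eqI[of "nat (- p)"]) auto
  qed
  moreover have "p \<notin> x" if "?M < p" for p
  proof
    assume "p \<in> x"
    then obtain i where "i \<ge> 1" "p = X i" using X(1) by auto
    then have "p \<le> X 1" using X(2)[of 1 i] by (cases "i = 1") auto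
    then show False using that by linarith
  qed
  ultimately have "\<forall>p\<in>x. p \<le> ?M" "\<forall>p. p \<notin> x \<longrightarrow> - ?M \<le> p" by (metis not_le)+
  moreover have "0 \<le> ?M" by simp
  ultimately show thesis using that by blast
qed

text \<open>By \<open>between\<close>, no other particle separates \<open>q\<close> from
  \<open>h\<close>. The moved particle therefore keeps its rank \<open>k\<close>, and changing the
  enumeration at the single index \<open>k\<close> leaves it decreasing. Jumps of TASEP to the right
  and of the BHP to the left are both of this kind.\<close>

lemma configs_insert_remove:
  assumes x: "x \<in> configs" and q: "q \<in> x" and h: "h \<notin> x"
    and between: "\<And>z. z \<in> x \<Longrightarrow> z \<noteq> q \<Longrightarrow> z < q \<longleftrightarrow> z < h"
  shows "insert h (x - {q}) \<in> configs"
proof -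
  from configsE[OF x] obtain X N0 where X: "x = X ` {1..}" "\<And>i. i \<ge> 1 \<Longrightarrow> X (Suc i) < X i"
    "inj_on X {1..}" "\<And>N. N \<ge> N0 \<Longrightarrow> X N = - int N" by metis
  obtain k where k: "k \<ge> 1" "q = X k" using q X(1) by auto
  define Y where "Y = X(k := h)"
  have "Y (Suc i) < Y i" if i: "i \<ge> 1" for i
  proof -
    have mem: "X i \<in> x" "X (Suc i) \<in> x" using X(1) i by auto
    moreover from this have "X i \<noteq> h" "X (Suc i) \<noteq> h" using h by auto
    ultimately show ?thesis
      using X(2)[OF i] between[OF mem(1)] between[OF mem(2)] k
      by (cases "i = k"; cases "Suc i = k") (auto simp: Y_def)
  qed
  moreover have "\<forall>\<^sub>F N in sequentially. Y N = - int N"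
    unfolding eventually_sequentially by (rule exI[of _ "max N0 (Suc k)"]) (auto simp: Y_def X(4))
  moreover have "insert h (x - {q}) = Y ` {1..}"
  proof -
    have "X ` {1..} - {X k} = X ` ({1..} - {k})"
      using inj_on_image_set_diff[OF X(3), of "{1..}" "{k}"] k by auto
    moreover have "Y ` {1..} = insert h (X ` ({1..} - {k}))"
      using k by (auto simp: Y_def image_iff)
    ultimately show ?thesis using X(1) k by simp
  qed
  ultimately show ?thesis unfolding configs_def by blast
qed

lemma step_config_in_configs: "step_config \<in> configs"
proof -
  have "\<forall>i\<ge>1. - int (Suc i) < - int i" "\<forall>\<^sub>F N in sequentially. - int N = - int N" by simp_all
  then show ?thesis unfolding step_config_def configs_def by blast
qed

text \<open>
  In terms of the particles, the sum of all \<open>x k + k\<close>: the number of boxes of the Young diagram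
  of the configuration.
\<close>

definition area :: "int set \<Rightarrow> int" where
  "area x = (\<Sum>p\<in>x \<inter> {0..}. p) - (\<Sum>p\<in>{..<0} - x. p)"

lemma configs_finite:
  assumes "x \<in> configs"
  shows "finite (x \<inter> {0..})" "finite ({..<0} - x)" "finite {p \<in> x. h < p}"
    "finite {p \<in> x. p + 1 \<notin> x}"
proof -
  obtain M where M: "\<forall>p\<in>x. p \<le> M" "\<forall>p. p \<notin> x \<longrightarrow> - M \<le> p"
    using configs_bounded[OF assms] by metis
  note le = bspec[OF M(1)] and ge = mp[OF spec[OF M(2)]]
  have "x \<inter> {0..} \<subseteq> {0..M}" "{..<0} - x \<subseteq> {- M..0}" "{p \<in> x. h < p} \<subseteq> {h..M}"
    "{p \<in> x. p + 1 \<notin> x} \<subseteq> {- M - 1..M}"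
    by (auto dest!: le ge)
  then show "finite (x \<inter> {0..})" "finite ({..<0} - x)" "finite {p \<in> x. h < p}"
    "finite {p \<in> x. p + 1 \<notin> x}"
    by (auto intro: finite_subset)
qed

lemma area_insert_remove:
  assumes x: "x \<in> configs" and p: "p \<in> x" and q: "q \<notin> x"
  shows "area (insert q (x - {p})) = area x + q - p"
proof -
  let ?y = "insert q (x - {p})"
  note fin = configs_finite[OF x]
  have "?y \<inter> {0..} = (if q \<ge> 0 then insert q (x \<inter> {0..} - {p}) else x \<inter> {0..} - {p})" by auto
  moreover have "(\<Sum>z\<in>x \<inter> {0..} - {p}. z) = (\<Sum>z\<in>x \<inter> {0..}. z) - (if p \<ge> 0 then p else 0)"
    using fin(1) p by (subst sum_diff1) auto
  ultimately have 1: "(\<Sum>z\<in>?y \<inter> {0..}. z) = (\<Sum>z\<in>x \<inter> {0..}. z) - (if p \<ge> 0 then p else 0) + (if q \<ge> 0 then q else 0)"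
    using fin(1) q by simp
  have "{..<0} - ?y = (if p < 0 then insert p ({..<0} - x - {q}) else {..<0} - x - {q})" using p q by auto
  moreover have "(\<Sum>z\<in>{..<0} - x - {q}. z) = (\<Sum>z\<in>{..<0} - x. z) - (if q < 0 then q else 0)"
    using fin(2) q by (subst sum_diff1) auto
  ultimately have 2: "(\<Sum>z\<in>{..<0} - ?y. z) = (\<Sum>z\<in>{..<0} - x. z) - (if q < 0 then q else 0) + (if p < 0 then p else 0)"
    using fin(2) p by simp
  show ?thesis unfolding area_def 1 2 by simp
qed

text \<open>Every particle at a nonnegative site and every hole at a negative site contributes a
  nonnegative term to the area, so a single one of them already bounds it from below.\<close>

lemma area_ge:
  assumes x: "x \<in> configs"
  shows "0 \<le> area x" "p \<in> x \<Longrightarrow> p \<le> area x" "p \<notin> x \<Longrightarrow> - area x \<le> p"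
proof -
  note fin = configs_finite[OF x]
  have 1: "0 \<le> (\<Sum>p\<in>x \<inter> {0..}. p)" by (intro sum_nonneg) auto
  have 2: "(\<Sum>p\<in>{..<0} - x. p) \<le> 0" by (intro sum_nonpos) auto
  show 0: "0 \<le> area x" using 1 2 by (simp add: area_def)
  show "p \<le> area x" if "p \<in> x"
  proof (cases "0 \<le> p")
    case True
    then have "p \<le> (\<Sum>p\<in>x \<inter> {0..}. p)" using fin(1) that by (intro member_le_sum) auto
    then show ?thesis using 2 by (simp add: area_def)
  qed (use 0 in simp)
  show "- area x \<le> p" if "p \<notin> x"
  proof (cases "p < 0")
    case True
    then have "- p \<le> (\<Sum>p\<in>{..<0} - x. - p)" using fin(2) that by (intro member_le_sum) auto
    then show ?thesis using 1 by (simp add: area_def sum_negf)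
  qed (use 0 in simp)
qed

text \<open>By \<open>area_ge\<close> such a configuration is full to the left of \<open>- N\<close>
  and empty to the right of \<open>N\<close>, so it is determined by its trace on
  \<open>{- N..N}\<close>.\<close>

lemma finite_area_le: "finite {x \<in> configs. area x \<le> N}"
proof (rule finite_subset)
  show "{x \<in> configs. area x \<le> N} \<subseteq> (\<lambda>A. {..< - N} \<union> A) ` Pow {- N..N}"
  proof
    fix x assume "x \<in> {x \<in> configs. area x \<le> N}"
    then have x: "x \<in> configs" "area x \<le> N" by auto
    have "p \<le> N" if "p \<in> x" for p using area_ge(2)[OF x(1) that] x(2) by simp
    moreover have "- N \<le> p" if "p \<notin> x" for p using area_ge(3)[OF x(1) that] x(2) by simp
    ultimately have "x = {..< - N} \<union> (x \<inter> {- N..N})" by force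
    then show "x \<in> (\<lambda>A. {..< - N} \<union> A) ` Pow {- N..N}" by blast
  qed
qed simp

lemma countable_configs: "countable configs"
proof (rule countable_subset)
  have "x \<in> {x \<in> configs. area x \<le> int (nat (area x))}" if "x \<in> configs" for x
    using area_ge(1)[OF that] that by simp
  then show "configs \<subseteq> (\<Union>N::nat. {x \<in> configs. area x \<le> int N})" by blast
  show "countable (\<Union>N::nat. {x \<in> configs. area x \<le> int N})"
    by (rule countable_UN) (simp_all add: countable_finite finite_area_le)
qed

lemma step_config_eq: "step_config = {..<0}"
proof -
  have "p \<in> step_config" if "p < 0" for p :: int
    unfolding step_config_def by (rule rev_image_eqI[of "nat (- p)"]) (use that in auto)
  then show ?thesis by (auto simp: step_config_def)
qed

lemma area_step_config: "area step_config = 0"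
proof -
  have "{..<0} \<inter> {0::int..} = {}" by auto
  then show ?thesis by (simp add: area_def step_config_eq)
qed

section \<open>The moves of TASEP and of the BHP\<close>

lemma running_tasep: "running tasep_rate x = {p \<in> x. p + 1 \<notin> x}"
  by (auto simp: running_def tasep_rate_def)

lemma tasep_move_configs:
  assumes "x \<in> configs" "p \<in> running tasep_rate x"
  shows "tasep_move x p \<in> configs" "area (tasep_move x p) = area x + 1"
proof -
  have p: "p \<in> x" "p + 1 \<notin> x" using assms(2) by (auto simp: running_tasep)
  show "tasep_move x p \<in> configs"
    unfolding tasep_move_def by (rule configs_insert_remove[OF assms(1) p]) linarith
  show "area (tasep_move x p) = area x + 1"
    unfolding tasep_move_def using area_insert_remove[OF assms(1) p] by simp
qed

text \<open>A free particle at \<open>p \<ge> 1\<close> adds \<open>p\<close> to the area, and one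
  at \<open>p < -1\<close> is followed by a negative hole \<open>p + 1\<close>, which adds at least
  1. The two sites left over, -1 and 0, account for the constant 2.\<close>

lemma card_running_tasep_le:
  assumes x: "x \<in> configs"
  shows "int (card (running tasep_rate x)) \<le> area x + 2"
proof -
  let ?R = "running tasep_rate x"
  note fin = configs_finite[OF x]
  have fR: "finite ?R" using fin(4) by (simp add: running_tasep)
  have "int (card (?R \<inter> {1..})) = (\<Sum>p\<in>?R \<inter> {1..}. 1)" by simp
  also have "\<dots> \<le> (\<Sum>p\<in>?R \<inter> {1..}. p)" by (intro sum_mono) auto
  also have "\<dots> \<le> (\<Sum>p\<in>x \<inter> {0..}. p)" by (intro sum_mono2 fin) (auto simp: running_tasep)
  finally have 1: "int (card (?R \<inter> {1..})) \<le> (\<Sum>p\<in>x \<inter> {0..}. p)" .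
  have "int (card (?R \<inter> {..<-1})) \<le> int (card ({..<0} - x))"
    by (intro of_nat_mono card_inj_on_le[of "\<lambda>p. p + 1"] fin) (auto simp: running_tasep)
  also have "\<dots> = (\<Sum>p\<in>{..<0} - x. 1)" by simp
  also have "\<dots> \<le> (\<Sum>p\<in>{..<0} - x. - p)" by (intro sum_mono) auto
  finally have 2: "int (card (?R \<inter> {..<-1})) \<le> - (\<Sum>p\<in>{..<0} - x. p)" by (simp add: sum_negf)
  have "?R \<subseteq> (?R \<inter> {1..}) \<union> (?R \<inter> {..<-1}) \<union> {-1, 0}" by auto
  then have "card ?R \<le> card ((?R \<inter> {1..}) \<union> (?R \<inter> {..<-1}) \<union> {-1, 0})"
    by (intro card_mono) (use fR in auto)
  also have "\<dots> \<le> card (?R \<inter> {1..}) + card (?R \<inter> {..<-1}) + card {-1, 0 :: int}"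
    by (meson add_mono card_Un_le le_refl order_trans)
  finally show ?thesis using 1 2 by (simp add: area_def)
qed

lemma running_bhp:
  assumes "x \<in> configs"
  shows "running bhp_rate x = {h. h \<notin> x \<and> (\<exists>p\<in>x. h < p)}"
  using configs_finite(3)[OF assms] by (auto simp: running_def bhp_rate_def card_gt_0_iff)

lemma bhp_moveI:
  assumes "x \<in> configs" "q \<in> x" "h < q" "\<And>z. z \<in> x \<Longrightarrow> h < z \<Longrightarrow> q \<le> z"
  shows "bhp_move x h = insert h (x - {q})"
proof -
  have "Min {p \<in> x. h < p} = q"
    by (rule Min_eqI) (use assms configs_finite(3) in auto)
  then show ?thesis by (simp add: bhp_move_def)
qed

definition bhp_particle :: "int set \<Rightarrow> int \<Rightarrow> int" where
  "bhp_particle x h = Min {p \<in> x. h < p}"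

lemma bhp_particle:
  assumes x: "x \<in> configs" and h: "h \<in> running bhp_rate x"
  shows "bhp_particle x h \<in> x" "h < bhp_particle x h" "\<And>z. z \<in> x \<Longrightarrow> h < z \<Longrightarrow> bhp_particle x h \<le> z"
    "bhp_move x h = insert h (x - {bhp_particle x h})"
proof -
  have "{p \<in> x. h < p} \<noteq> {}" using h by (auto simp: running_bhp[OF x])
  note Min_in[OF configs_finite(3)[OF x] this] Min_le[OF configs_finite(3)[OF x]]
  then show "bhp_particle x h \<in> x" "h < bhp_particle x h" "\<And>z. z \<in> x \<Longrightarrow> h < z \<Longrightarrow> bhp_particle x h \<le> z"
    "bhp_move x h = insert h (x - {bhp_particle x h})"
    by (auto simp: bhp_move_def bhp_particle_def)
qed

lemma finite_running_bhp:
  assumes x: "x \<in> configs"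
  shows "finite (running bhp_rate x)"
proof -
  obtain M where M: "\<forall>p\<in>x. p \<le> M" "\<forall>p. p \<notin> x \<longrightarrow> - M \<le> p"
    using configs_bounded[OF x] by metis
  have "running bhp_rate x \<subseteq> {- M..M}"
  proof
    fix h assume "h \<in> running bhp_rate x"
    then obtain p where "h \<notin> x" "p \<in> x" "h < p" by (auto simp: running_bhp[OF x])
    moreover from this have "- M \<le> h" "p \<le> M"
      using M by simp_all
    ultimately show "h \<in> {- M..M}" by simp
  qed
  then show ?thesis by (rule finite_subset) simp
qed

lemma bhp_move_configs:
  assumes x: "x \<in> configs" and h: "h \<in> running bhp_rate x"
  shows "bhp_move x h \<in> configs" "area (bhp_move x h) < area x"
proof -
  let ?q = "bhp_particle x h"
  note q = bhp_particle[OF assms]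
  have "h \<notin> x" using h by (simp add: running_bhp[OF x])
  moreover have "z < ?q \<longleftrightarrow> z < h" if "z \<in> x" for z
    using q(2) q(3)[OF that] that \<open>h \<notin> x\<close> by (cases z h rule: linorder_cases) auto
  ultimately show "bhp_move x h \<in> configs" "area (bhp_move x h) < area x"
    using configs_insert_remove[OF x q(1), of h] area_insert_remove[OF x q(1), of h] q(2,4) by auto
qed

interpretation tasep: clock_chain tasep_rate tasep_move configs
proof
  show "countable configs" by (rule countable_configs)
  show "finite (running tasep_rate x)" if "x \<in> configs" for x
    unfolding running_tasep by (rule configs_finite(4)[OF that])
qed (rule tasep_move_configs)

interpretation bhp: clock_chain bhp_rate bhp_move configs
  by (rule clock_chain.intro) (rule countable_configs finite_running_bhp bhp_move_configs; assumption?)+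

section \<open>The commutator of the two generators\<close>

abbreviation tasep_gen :: "(int set \<Rightarrow> real) \<Rightarrow> int set \<Rightarrow> real" where
  "tasep_gen \<equiv> generator tasep_rate tasep_move"

abbreviation bhp_gen :: "(int set \<Rightarrow> real) \<Rightarrow> int set \<Rightarrow> real" where
  "bhp_gen \<equiv> generator bhp_rate bhp_move"

text \<open>The BHP rate of a hole, extended to occupied sites: after a TASEP step from
  \<open>p\<close> the site \<open>p\<close> is a hole, and its rate is expressed through the value
  at \<open>p\<close> before the step.\<close>

definition particles_right :: "int set \<Rightarrow> int \<Rightarrow> real" where
  "particles_right x h = real (card {p \<in> x. h < p})"

lemma tasep_gen_eq: "tasep_gen f x = (\<Sum>p\<in>running tasep_rate x. f (tasep_move x p) - f x)"
  unfolding generator_def by (intro sum.cong refl) (simp add: running_tasep tasep_rate_def)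

lemma bhp_gen_eq:
  assumes "x \<in> configs"
  shows "bhp_gen f x = (\<Sum>h\<in>running bhp_rate x. particles_right x h * (f (bhp_move x h) - f x))"
  unfolding generator_def
  by (rule sum.cong) (auto simp: running_bhp[OF assms] bhp_rate_def particles_right_def)

text \<open>The step fills the hole \<open>p + 1\<close> and creates the hole \<open>p\<close>. A
  ring at \<open>p\<close> undoes the step, and the moved particle is the additional one to the
  right of \<open>p\<close>, whence the \<open>+ 1\<close> in the rate. All other holes keep their
  rates. Their jumps commute with the step, unless the jumping particle is the moved one; then the
  step leaves no trace.\<close>

lemma bhp_gen_tasep_move:
  assumes x: "x \<in> configs" and p: "p \<in> running tasep_rate x"
  shows "bhp_gen f (tasep_move x p) = (particles_right x p + 1) * (f x - f (tasep_move x p)) +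
    (\<Sum>h\<in>running bhp_rate x - {p + 1}. particles_right x h *
       ((if bhp_particle x h = p then f (bhp_move x h) else f (tasep_move (bhp_move x h) p)) - f (tasep_move x p)))"
proof -
  let ?y = "tasep_move x p" and ?H = "running bhp_rate x"
  have p': "p \<in> x" "p + 1 \<notin> x" using p by (auto simp: running_tasep)
  have y: "?y \<in> configs" by (rule tasep_move_configs(1)[OF x p])
  have yeq: "?y = insert (p + 1) (x - {p})" by (simp add: tasep_move_def)
  have H: "running bhp_rate ?y = insert p (?H - {p + 1})"
  proof (rule set_eqI)
    fix h
    have "(\<exists>z\<in>?y. h < z) \<longleftrightarrow> (\<exists>z\<in>x. h < z)" if "h \<noteq> p"
    proof -
      have "h < p + 1 \<longleftrightarrow> h < p" using that by linarith
      then show ?thesis using p' unfolding yeq by auto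
    qed
    moreover have "p < p + 1" "p + 1 \<in> ?y" "p \<notin> ?y" by (auto simp: yeq)
    ultimately show "h \<in> running bhp_rate ?y \<longleftrightarrow> h \<in> insert p (?H - {p + 1})"
      unfolding running_bhp[OF y] running_bhp[OF x] using p' by (cases "h = p") (auto simp: yeq)
  qed
  have move_p: "bhp_move ?y p = x"
  proof -
    have "bhp_move ?y p = insert p (?y - {p + 1})"
      by (rule bhp_moveI[OF y]) (auto simp: yeq)
    then show ?thesis using p' by (auto simp: yeq)
  qed
  have right_p: "particles_right ?y p = particles_right x p + 1"
  proof -
    have "{z \<in> ?y. p < z} = insert (p + 1) {z \<in> x. p < z}" using p' by (auto simp: yeq)
    then show ?thesis using p' configs_finite(3)[OF x, of p] by (simp add: particles_right_def)
  qed
  have right: "particles_right ?y h = particles_right x h" if h: "h \<in> ?H - {p + 1}" for h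
  proof -
    have ne: "h \<noteq> p" using h p' by (auto simp: running_bhp[OF x])
    have "card {z \<in> ?y. h < z} = card {z \<in> x. h < z}"
    proof (cases "h < p")
      case True
      then have "{z \<in> ?y. h < z} = insert (p + 1) ({z \<in> x. h < z} - {p})" by (auto simp: yeq)
      moreover have "card (insert (p + 1) ({z \<in> x. h < z} - {p})) = Suc (card ({z \<in> x. h < z} - {p}))"
        using p' configs_finite(3)[OF x, of h] by (intro card_insert_disjoint) auto
      moreover have "\<dots> = card {z \<in> x. h < z}"
        using True p' configs_finite(3)[OF x, of h] by (intro card_Suc_Diff1) auto
      ultimately show ?thesis by simp
    next
      case False
      then have "{z \<in> ?y. h < z} = {z \<in> x. h < z}" using ne by (auto simp: yeq)
      then show ?thesis by simp
    qed
    then show ?thesis by (simp add: particles_right_def)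
  qed
  have move: "bhp_move ?y h = (if bhp_particle x h = p then bhp_move x h else tasep_move (bhp_move x h) p)"
    if h: "h \<in> ?H - {p + 1}" for h
  proof -
    let ?q = "bhp_particle x h"
    have hH: "h \<in> ?H" and ne: "h \<noteq> p + 1" "h \<notin> x" using h by (auto simp: running_bhp[OF x])
    note q = bhp_particle[OF x hH]
    show ?thesis
    proof (cases "?q = p")
      case True
      have "bhp_move ?y h = insert h (?y - {p + 1})"
      proof (rule bhp_moveI[OF y])
        show "p + 1 \<in> ?y" "h < p + 1" using q(2) True by (auto simp: yeq)
        show "p + 1 \<le> z" if "z \<in> ?y" "h < z" for z
          using that q(3)[of z] True by (cases "z = p") (auto simp: yeq)
      qed
      then show ?thesis using True q(4) p' by (auto simp: yeq)
    next
      case False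
      have "bhp_move ?y h = insert h (?y - {?q})"
      proof (rule bhp_moveI[OF y])
        show "?q \<in> ?y" "h < ?q" using q(1,2) False by (auto simp: yeq)
        show "?q \<le> z" if "z \<in> ?y" "h < z" for z
        proof (cases "z = p + 1")
          case True
          then have "h < p" using that ne p' by (cases "h = p") auto
          then show ?thesis using q(3)[of p] p' True by simp
        qed (use that q(3) in \<open>auto simp: yeq\<close>)
      qed
      moreover have "?q \<noteq> p + 1" "h \<noteq> p" using q(1) p' ne by auto
      then have "insert h (?y - {?q}) = insert (p + 1) (insert h (x - {?q}) - {p})"
        unfolding yeq by blast
      ultimately show ?thesis using False by (simp only: q(4) tasep_move_def if_False)
    qed
  qed
  have "p \<notin> ?H" using p' by (simp add: running_bhp[OF x])
  then have "bhp_gen f ?y = particles_right ?y p * (f (bhp_move ?y p) - f ?y) +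
     (\<Sum>h\<in>?H - {p + 1}. particles_right ?y h * (f (bhp_move ?y h) - f ?y))"
    unfolding bhp_gen_eq[OF y] H using finite_running_bhp[OF x] by (subst sum.insert) simp_all
  also have "(\<Sum>h\<in>?H - {p + 1}. particles_right ?y h * (f (bhp_move ?y h) - f ?y)) =
    (\<Sum>h\<in>?H - {p + 1}. particles_right x h *
       ((if bhp_particle x h = p then f (bhp_move x h) else f (tasep_move (bhp_move x h) p)) - f ?y))"
    by (rule sum.cong[OF refl]) (simp add: right move if_distrib)
  finally show ?thesis by (simp only: move_p right_p)
qed

text \<open>The particle that has arrived at \<open>h\<close> is free. Its step returns to
  \<open>x\<close> if it came from \<open>h + 1\<close>, and otherwise produces the jump into the
  hole \<open>h + 1\<close>. Among the particles free in \<open>x\<close>, the jumping one has left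
  its site, and a particle at \<open>h - 1\<close> is now blocked; the others stay free.\<close>

lemma tasep_gen_bhp_move:
  assumes x: "x \<in> configs" and h: "h \<in> running bhp_rate x"
  shows "tasep_gen f (bhp_move x h) =
    f (if h + 1 \<in> x then x else bhp_move x (h + 1)) - f (bhp_move x h) +
    (\<Sum>p\<in>running tasep_rate x - {bhp_particle x h, h - 1}. f (tasep_move (bhp_move x h) p) - f (bhp_move x h))"
proof -
  let ?q = "bhp_particle x h" and ?y = "bhp_move x h"
  note q = bhp_particle[OF x h]
  have hx: "h \<notin> x" using h by (auto simp: running_bhp[OF x])
  have next_particle: "h + 1 \<in> x \<longleftrightarrow> ?q = h + 1"
    using q(1) q(2) q(3)[of "h + 1"] by auto
  have before: "z \<notin> x" if "h < z" "z < ?q" for z using q(3)[of z] that by auto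
  have R: "running tasep_rate ?y = insert h (running tasep_rate x - {?q, h - 1})"
    unfolding running_tasep q(4)
  proof (intro set_eqI)
    fix p
    \<comment> \<open>The departure of \<open>?q\<close> frees no other particle, because all sites
      from \<open>h\<close> up to \<open>?q - 1\<close> are empty in \<open>x\<close>.\<close>
    have "p + 1 \<noteq> ?q" if "p \<in> x"
    proof
      assume "p + 1 = ?q"
      moreover from this have "h \<noteq> p" "h \<le> p" using that hx q(2) by auto
      ultimately show False using before[of p] that by simp
    qed
    then show "p \<in> {p \<in> insert h (x - {?q}). p + 1 \<notin> insert h (x - {?q})} \<longleftrightarrow>
      p \<in> insert h ({p \<in> x. p + 1 \<notin> x} - {?q, h - 1})"
      using hx q(1,2) next_particle by (cases "p = h") auto
  qed
  have "tasep_move ?y h = (if h + 1 \<in> x then x else bhp_move x (h + 1))"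
  proof (cases "h + 1 \<in> x")
    case True
    then show ?thesis using next_particle q hx by (auto simp: tasep_move_def)
  next
    case False
    then have "h + 1 < ?q" using next_particle q(2) by linarith
    then have "bhp_move x (h + 1) = insert (h + 1) (x - {?q})"
      using q by (intro bhp_moveI[OF x]) auto
    then show ?thesis using False q hx by (auto simp: tasep_move_def)
  qed
  moreover have "h \<notin> running tasep_rate x" using hx by (simp add: running_tasep)
  moreover have "finite (running tasep_rate x)" using configs_finite(4)[OF x] by (simp add: running_tasep)
  ultimately show ?thesis
    unfolding tasep_gen_eq R by (subst sum.insert) auto
qed

lemma sum_int_telescope:
  fixes g :: "int \<Rightarrow> 'a :: ab_group_add"
  assumes "g a = g (b + 1)"
  shows "(\<Sum>i\<in>{a..b}. g (i + 1) - g i) = 0"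
proof (cases "a \<le> b")
  case True
  have "(\<Sum>i\<in>{a..b}. g (i + 1)) = (\<Sum>i\<in>{a + 1..b + 1}. g i)"
    by (rule sum.reindex_bij_witness[where i = "\<lambda>i. i - 1" and j = "\<lambda>i. i + 1"]) auto
  also have "{a + 1..b + 1} = insert (b + 1) {a + 1..b}" using True by auto
  also have "sum g \<dots> = g a + sum g {a + 1..b}" using assms by simp
  also have "\<dots> = sum g (insert a {a + 1..b})" by simp
  also have "insert a {a + 1..b} = {a..b}" using True by auto
  finally show ?thesis by (simp add: sum_subtractf)
qed simp

text \<open>
  With \<open>g h\<close> the contribution of the hole \<open>h\<close> to \<open>bhp_gen f x\<close>, letting a particle take the TASEP
  step directly after it jumped into \<open>h\<close> contributes \<open>g (h + 1) - g h\<close>. These differences telescope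
  over each gap, up to the term at the hole in front of the particle that bounds the gap on the left.
\<close>

lemma particles_right_eq_0:
  assumes "x \<in> configs" "h \<notin> x" "h \<notin> running bhp_rate x"
  shows "particles_right x h = 0"
proof -
  have "{p \<in> x. h < p} = {}" using assms by (auto simp: running_bhp)
  then show ?thesis unfolding particles_right_def by (simp only: card.empty of_nat_0)
qed

lemma bhp_gap_telescope:
  fixes f :: "int set \<Rightarrow> real"
  assumes x: "x \<in> configs"
  defines "g \<equiv> \<lambda>h. if h \<in> x then 0 else particles_right x h * (f (bhp_move x h) - f x)"
  shows "(\<Sum>h\<in>running bhp_rate x. particles_right x h *
      (f (if h + 1 \<in> x then x else bhp_move x (h + 1)) - f (bhp_move x h)))
    + (\<Sum>p\<in>running tasep_rate x. g (p + 1)) = 0"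
proof -
  let ?H = "running bhp_rate x" and ?R = "running tasep_rate x"
  obtain M where M: "0 \<le> M" "\<forall>p\<in>x. p \<le> M" "\<forall>p. p \<notin> x \<longrightarrow> - M \<le> p"
    using configs_bounded[OF x] by metis
  \<comment> \<open>The margin makes the window contain all running holes and all free particles.
    Moreover \<open>g\<close> vanishes at its left end, which is occupied, and just past its right
    end, which has no particle to its right.\<close>
  let ?I = "{- M - 2..M + 2}"
  note none = particles_right_eq_0[OF x]
  \<comment> \<open>If \<open>h + 1\<close> is occupied, \<open>g (h + 1) = 0\<close> and the target
    is \<open>x\<close> itself. Otherwise \<open>h\<close> and \<open>h + 1\<close> have the same
    particles to their right, hence equal rates.\<close>
  have H: "particles_right x h * (f (if h + 1 \<in> x then x else bhp_move x (h + 1)) - f (bhp_move x h)) = g (h + 1) - g h"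
    if h: "h \<in> ?H" for h
  proof (cases "h + 1 \<in> x")
    case True
    then show ?thesis using h by (auto simp: g_def running_bhp[OF x] algebra_simps)
  next
    case False
    then have "h + 1 < p \<longleftrightarrow> h < p" if "p \<in> x" for p
      using that by (cases "p = h + 1") auto
    then have "{p \<in> x. h + 1 < p} = {p \<in> x. h < p}" by blast
    then show ?thesis using h False by (auto simp: g_def particles_right_def running_bhp[OF x] algebra_simps)
  qed
  note le = bspec[OF M(2)] and ge = mp[OF spec[OF M(3)]]
  have sub: "?H \<subseteq> ?I" "?R \<subseteq> ?I"
    by (force simp: running_bhp[OF x] running_tasep dest: le ge)+
  have "g i = 0" if "i \<notin> x" "i \<notin> ?H" for i using none that by (simp add: g_def)
  moreover have "i + 1 \<notin> ?H" if "i \<notin> x" "i \<notin> ?H" for i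
  proof
    assume "i + 1 \<in> ?H"
    then obtain p where "p \<in> x" "i + 1 < p" by (auto simp: running_bhp[OF x])
    then have "i \<in> ?H" using that by (auto simp: running_bhp[OF x] intro!: bexI[of _ p])
    then show False using that by simp
  qed
  moreover from this have "g (i + 1) = 0" if "i \<notin> x" "i \<notin> ?H" for i
    using that by (cases "i + 1 \<in> x") (simp_all add: g_def none)
  moreover have "g i = 0" "g (i + 1) = 0" if "i \<in> x" "i \<notin> ?R" for i
    using that by (simp_all add: g_def running_tasep)
  ultimately have "g i = 0 \<and> g (i + 1) = 0" if "i \<notin> ?H \<union> ?R" for i
    using that by (cases "i \<in> x") auto
  then have "(\<Sum>i\<in>?I. g (i + 1) - g i) = (\<Sum>i\<in>?H \<union> ?R. g (i + 1) - g i)"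
    using sub by (intro sum.mono_neutral_right) auto
  also have "\<dots> = (\<Sum>i\<in>?H. g (i + 1) - g i) + (\<Sum>i\<in>?R. g (i + 1) - g i)"
    using finite_running_bhp[OF x] configs_finite(4)[OF x]
    by (intro sum.union_disjoint) (auto simp: running_tasep running_bhp[OF x])
  also have "(\<Sum>i\<in>?R. g (i + 1) - g i) = (\<Sum>i\<in>?R. g (i + 1))"
    by (rule sum.cong) (auto simp: running_tasep g_def)
  also have "(\<Sum>i\<in>?I. g (i + 1) - g i) = 0"
  proof (rule sum_int_telescope)
    have "M + 2 + 1 \<notin> x" "M + 2 + 1 \<notin> ?H" using le[of "M + 2 + 1"] M(1) sub(1) by auto
    moreover have "- M - 2 \<in> x" using ge[of "- M - 2"] by force
    ultimately show "g (- M - 2) = g (M + 2 + 1)" by (simp add: g_def none)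
  qed
  finally show ?thesis using H by simp
qed

text \<open>Both compositions become double sums over a hole \<open>h\<close> and a free particle
  \<open>p\<close>, plus the terms in which one move acts on what the other has just created. The
  double sums cancel except for \<open>h = p + 1\<close>. What remains combines into the telescoping
  expression of \<open>bhp_gap_telescope\<close>, with the surplus rate 1 of undoing a TASEP step
  left over; this surplus is the right-hand side.\<close>

lemma bhp_tasep_commutator:
  assumes x: "x \<in> configs"
  shows "bhp_gen (tasep_gen f) x - tasep_gen (bhp_gen f) x = tasep_gen f x"
proof -
  let ?H = "running bhp_rate x" and ?R = "running tasep_rate x"
  let ?n = "particles_right x" and ?b = "bhp_move x" and ?t = "tasep_move x" and ?q = "bhp_particle x"
  let ?s = "\<lambda>h. if h + 1 \<in> x then x else ?b (h + 1)"
  let ?tb = "\<lambda>h p. f (tasep_move (?b h) p)"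
  have fin: "finite ?H" "finite ?R"
    using finite_running_bhp[OF x] configs_finite(4)[OF x] by (simp_all add: running_tasep)
  have Rx: "p \<in> x" "p + 1 \<notin> x" if "p \<in> ?R" for p using that by (auto simp: running_tasep)
  \<comment> \<open>\<open>?n h * a h p\<close> and \<open>b h p\<close> are the contributions of
    the pair of \<open>h\<close> and \<open>p\<close> to the two compositions. The zero branches
    mark a particle, respectively a hole, that the other move has disabled.\<close>
  define a where "a = (\<lambda>h p. (if p = ?q h \<or> p = h - 1 then 0 else ?tb h p - f (?b h)) - (f (?t p) - f x))"
  define b where "b = (\<lambda>h p. (if h = p + 1 then 0
      else ?n h * ((if ?q h = p then f (?b h) else ?tb h p) - f (?t p))) - ?n h * (f (?b h) - f x))"
  have 1: "bhp_gen (tasep_gen f) x = (\<Sum>h\<in>?H. ?n h * (f (?s h) - f (?b h))) + (\<Sum>h\<in>?H. \<Sum>p\<in>?R. ?n h * a h p)"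
  proof -
    have "tasep_gen f (?b h) - tasep_gen f x = f (?s h) - f (?b h) + (\<Sum>p\<in>?R. a h p)" if "h \<in> ?H" for h
    proof -
      have "(\<Sum>p\<in>?R - {?q h, h - 1}. ?tb h p - f (?b h)) =
          (\<Sum>p\<in>?R. if p = ?q h \<or> p = h - 1 then 0 else ?tb h p - f (?b h))"
        using fin by (intro sum.mono_neutral_cong_left) auto
      then show ?thesis
        unfolding tasep_gen_bhp_move[OF x that] by (simp add: a_def sum_subtractf tasep_gen_eq)
    qed
    then show ?thesis
      unfolding bhp_gen_eq[OF x] by (simp add: distrib_left sum.distrib sum_distrib_left)
  qed
  have 2: "tasep_gen (bhp_gen f) x = (\<Sum>p\<in>?R. (?n p + 1) * (f x - f (?t p))) + (\<Sum>p\<in>?R. \<Sum>h\<in>?H. b h p)"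
  proof -
    have "bhp_gen f (?t p) - bhp_gen f x = (?n p + 1) * (f x - f (?t p)) + (\<Sum>h\<in>?H. b h p)" if "p \<in> ?R" for p
    proof -
      have "(\<Sum>h\<in>?H - {p + 1}. ?n h * ((if ?q h = p then f (?b h) else ?tb h p) - f (?t p))) =
          (\<Sum>h\<in>?H. if h = p + 1 then 0 else ?n h * ((if ?q h = p then f (?b h) else ?tb h p) - f (?t p)))"
        using fin by (intro sum.mono_neutral_cong_left) auto
      then show ?thesis
        unfolding bhp_gen_tasep_move[OF x that] by (simp add: b_def sum_subtractf bhp_gen_eq[OF x])
    qed
    then show ?thesis
      unfolding tasep_gen_eq[of "bhp_gen f"] by (simp add: sum.distrib)
  qed
  \<comment> \<open>Pairs in which the particle \<open>p\<close> itself jumps into \<open>h\<close>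
    cancel as well. They do not interfere with \<open>h = p + 1\<close>, since a BHP jump goes to
    the left.\<close>
  have ab: "?n h * a h p - b h p = (if h = p + 1 then ?n h * (f (?b h) - f (?t p)) else 0)"
    if "h \<in> ?H" for h p
    using bhp_particle(2)[OF x that] by (auto simp: a_def b_def algebra_simps)
  have "(\<Sum>h\<in>?H. \<Sum>p\<in>?R. ?n h * a h p) - (\<Sum>p\<in>?R. \<Sum>h\<in>?H. b h p)
      = (\<Sum>p\<in>?R. \<Sum>h\<in>?H. ?n h * a h p - b h p)"
    by (subst sum.swap) (simp add: sum_subtractf)
  also have "\<dots> = (\<Sum>p\<in>?R. \<Sum>h\<in>?H. if h = p + 1 then ?n h * (f (?b h) - f (?t p)) else 0)"
    using ab by (intro sum.cong) auto
  also have "\<dots> = (\<Sum>p\<in>?R. ?n (p + 1) * (f (?b (p + 1)) - f (?t p)))"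
  proof (rule sum.cong[OF refl])
    fix p assume p: "p \<in> ?R"
    have "?n (p + 1) = 0" if "p + 1 \<notin> ?H"
      by (rule particles_right_eq_0[OF x Rx(2)[OF p] that])
    then show "(\<Sum>h\<in>?H. if h = p + 1 then ?n h * (f (?b h) - f (?t p)) else 0) = ?n (p + 1) * (f (?b (p + 1)) - f (?t p))"
      using fin by (auto simp: sum.delta)
  qed
  finally have cross: "(\<Sum>h\<in>?H. \<Sum>p\<in>?R. ?n h * a h p) - (\<Sum>p\<in>?R. \<Sum>h\<in>?H. b h p)
      = (\<Sum>p\<in>?R. ?n (p + 1) * (f (?b (p + 1)) - f (?t p)))" .
  have "?n (p + 1) = ?n p" if "p \<in> ?R" for p
  proof -
    have "z \<noteq> p + 1" if "z \<in> x" for z using Rx(2)[OF \<open>p \<in> ?R\<close>] that by auto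
    then have "p + 1 < z \<longleftrightarrow> p < z" if "z \<in> x" for z using that by force
    then have "{z \<in> x. p + 1 < z} = {z \<in> x. p < z}" by blast
    then show ?thesis by (simp add: particles_right_def)
  qed
  then have "(\<Sum>p\<in>?R. ?n (p + 1) * (f (?b (p + 1)) - f (?t p))) - (\<Sum>p\<in>?R. (?n p + 1) * (f x - f (?t p)))
     = (\<Sum>p\<in>?R. ?n (p + 1) * (f (?b (p + 1)) - f x) + (f (?t p) - f x))"
    unfolding sum_subtractf[symmetric] by (intro sum.cong) (auto simp: algebra_simps)
  also have "\<dots> = (\<Sum>p\<in>?R. ?n (p + 1) * (f (?b (p + 1)) - f x)) + tasep_gen f x"
    by (simp add: sum.distrib tasep_gen_eq)
  also have "(\<Sum>p\<in>?R. ?n (p + 1) * (f (?b (p + 1)) - f x)) = - (\<Sum>h\<in>?H. ?n h * (f (?s h) - f (?b h)))"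
    using bhp_gap_telescope[OF x, of f] Rx by (simp add: add_eq_0_iff2)
  finally show ?thesis using 1 2 cross by linarith
qed

section \<open>The intertwining relation\<close>

abbreviation tasep_trans :: "real \<Rightarrow> int set \<Rightarrow> int set \<Rightarrow> real" where
  "tasep_trans \<equiv> transition_prob tasep_rate tasep_move"

lemma tasep_trans_eq_0:
  assumes "x \<in> configs" "area y < area x"
  shows "tasep_trans t x y = 0"
  by (rule tasep.transition_prob_eq_0[where Q = "\<lambda>z. area x \<le> area z"])
    (use assms tasep_move_configs(2) in force)+

lemma bhp_trans_eq_0:
  assumes "x \<in> configs" "y \<notin> configs \<or> area x < area y"
  shows "bhp_trans \<tau> x y = 0"
  unfolding bhp_trans_def
  by (rule bhp.transition_prob_eq_0[where Q = "\<lambda>z. area z \<le> area x"])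
    (use assms bhp_move_configs(2) in force)+

text \<open>This is \<open>L\<^sub>\<tau> f\<close>. States of larger area have transition
  probability 0 by \<open>bhp_trans_eq_0\<close>, so the restriction loses nothing and keeps the sum
  finite for unbounded \<open>f\<close> too.\<close>

definition bhp_semigroup :: "real \<Rightarrow> (int set \<Rightarrow> real) \<Rightarrow> int set \<Rightarrow> real" where
  "bhp_semigroup \<tau> f x = (\<Sum>z\<in>{z \<in> configs. area z \<le> area x}. bhp_trans \<tau> x z * f z)"

text \<open>Provides one index set for a state and all its BHP successors, so that the generator can
  be interchanged with the sum.\<close>

lemma bhp_semigroup_superset:
  assumes "x \<in> configs" "area x \<le> N"
  shows "bhp_semigroup \<tau> f x = (\<Sum>z\<in>{z \<in> configs. area z \<le> N}. bhp_trans \<tau> x z * f z)"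
  unfolding bhp_semigroup_def
proof (rule sum.mono_neutral_left[OF finite_area_le])
  show "\<forall>z\<in>{z \<in> configs. area z \<le> N} - {z \<in> configs. area z \<le> area x}. bhp_trans \<tau> x z * f z = 0"
  proof
    fix z assume "z \<in> {z \<in> configs. area z \<le> N} - {z \<in> configs. area z \<le> area x}"
    then have "area x < area z" by auto
    then show "bhp_trans \<tau> x z * f z = 0" using bhp_trans_eq_0[OF assms(1)] by simp
  qed
qed (use assms in auto)

lemma bhp_semigroup_0:
  assumes "x \<in> configs"
  shows "bhp_semigroup 0 f x = f x"
proof -
  have "bhp_semigroup 0 f x = (\<Sum>z\<in>{z \<in> configs. area z \<le> area x}. if z = x then f z else 0)"
    unfolding bhp_semigroup_def bhp_trans_def bhp.transition_prob_0[OF assms] by (intro sum.cong) auto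
  then show ?thesis using assms finite_area_le by simp
qed

lemma bhp_semigroup_backward:
  assumes x: "x \<in> configs" and "0 \<le> \<tau>"
  shows "((\<lambda>\<tau>. bhp_semigroup \<tau> f x) has_real_derivative bhp_gen (bhp_semigroup \<tau> f) x) (at \<tau> within {0..})"
proof -
  let ?Z = "{z \<in> configs. area z \<le> area x}"
  have "((\<lambda>\<tau>. bhp_semigroup \<tau> f x) has_real_derivative (\<Sum>z\<in>?Z. bhp_gen (\<lambda>v. bhp_trans \<tau> v z) x * f z)) (at \<tau> within {0..})"
    unfolding bhp_semigroup_def bhp_trans_def
    by (intro DERIV_sum DERIV_cmult_right bhp.transition_prob_backward assms)
  also have "(\<Sum>z\<in>?Z. bhp_gen (\<lambda>v. bhp_trans \<tau> v z) x * f z) = bhp_gen (\<lambda>v. \<Sum>z\<in>?Z. f z * bhp_trans \<tau> v z) x"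
    by (simp add: generator_sum generator_cmult mult.commute)
  also have "\<dots> = bhp_gen (bhp_semigroup \<tau> f) x"
    using x bhp_move_configs[OF x]
    by (intro generator_cong) (auto simp: bhp_semigroup_superset[where N = "area x"] mult.commute less_imp_le)
  finally show ?thesis .
qed

text \<open>Every jump lowers the area, so by induction the values at the successors of
  \<open>x\<close> vanish. At \<open>x\<close> there remains the scalar equation with derivative
  \<open>- ?c * \<phi> \<tau> x\<close>, settled by an integrating factor.\<close>

lemma bhp_backward_unique:
  assumes deriv: "\<And>x \<tau>. x \<in> configs \<Longrightarrow> 0 \<le> \<tau> \<Longrightarrow>
      ((\<lambda>\<tau>. \<phi> \<tau> x) has_real_derivative bhp_gen (\<phi> \<tau>) x) (at \<tau> within {0..})"
    and init: "\<And>x. x \<in> configs \<Longrightarrow> \<phi> 0 x = 0"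
    and x: "x \<in> configs" and "0 \<le> \<tau>"
  shows "\<phi> \<tau> x = 0"
  using x \<open>0 \<le> \<tau>\<close>
proof (induction "nat (area x)" arbitrary: x \<tau> rule: less_induct)
  case less
  let ?c = "bhp.total_rate x"
  have "((\<lambda>\<tau>. exp (?c * \<tau>) * \<phi> \<tau> x) has_real_derivative 0) (at \<tau> within {0..})" if "0 \<le> \<tau>" for \<tau>
  proof -
    have "\<phi> \<tau> (bhp_move x h) = 0" if "h \<in> running bhp_rate x" for h
      using bhp_move_configs[OF less.prems(1) that] area_ge(1)[OF bhp_move_configs(1)[OF less.prems(1) that]] \<open>0 \<le> \<tau>\<close>
      by (intro less.hyps) auto
    then have "bhp_gen (\<phi> \<tau>) x = - (?c * \<phi> \<tau> x)"
      by (simp add: generator_def bhp.total_rate_def sum_distrib_right sum_negf)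
    with has_real_derivative_exp_mult[OF deriv[OF less.prems(1) that], of ?c] show ?thesis by simp
  qed
  then obtain a where "\<And>\<tau>. \<tau> \<in> {0..} \<Longrightarrow> exp (?c * \<tau>) * \<phi> \<tau> x = a"
    using has_field_derivative_zero_constant[of "{0..}" "\<lambda>\<tau>. exp (?c * \<tau>) * \<phi> \<tau> x"] by auto
  from this[of \<tau>] this[of 0] show ?case using less.prems init by simp
qed

text \<open>That the transition probabilities out of a state sum to 1 follows from uniqueness: the
  constant 1 solves the backward equation with the same initial value.\<close>

lemma bhp_semigroup_const_1:
  assumes "x \<in> configs" "0 \<le> \<tau>"
  shows "bhp_semigroup \<tau> (\<lambda>_. 1) x = 1"
proof -
  have "bhp_semigroup \<tau> (\<lambda>_. 1) x - 1 = 0"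
  proof (rule bhp_backward_unique[of "\<lambda>\<tau> x. bhp_semigroup \<tau> (\<lambda>_. 1) x - 1"])
    fix x and \<tau> :: real assume *: "x \<in> configs" "0 \<le> \<tau>"
    then show "((\<lambda>\<tau>. bhp_semigroup \<tau> (\<lambda>_. 1) x - 1) has_real_derivative
        bhp_gen (\<lambda>x. bhp_semigroup \<tau> (\<lambda>_. 1) x - 1) x) (at \<tau> within {0..})"
      using DERIV_diff[OF bhp_semigroup_backward[OF *] DERIV_const]
      by (simp add: generator_diff generator_const)
  qed (use assms in \<open>auto simp: bhp_semigroup_0\<close>)
  then show ?thesis by simp
qed

lemma bhp_semigroup_bounds:
  assumes "x \<in> configs" "0 \<le> \<tau>" "\<And>z. 0 \<le> f z" "\<And>z. f z \<le> 1"
  shows "0 \<le> bhp_semigroup \<tau> f x" "bhp_semigroup \<tau> f x \<le> 1"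
proof -
  have nonneg: "0 \<le> bhp_trans \<tau> x z" for z by (simp add: bhp_trans_def bhp.transition_prob_nonneg)
  then show "0 \<le> bhp_semigroup \<tau> f x"
    unfolding bhp_semigroup_def using assms by (intro sum_nonneg mult_nonneg_nonneg) auto
  have "bhp_semigroup \<tau> f x \<le> bhp_semigroup \<tau> (\<lambda>_. 1) x"
    unfolding bhp_semigroup_def using assms nonneg by (intro sum_mono mult_left_mono) auto
  then show "bhp_semigroup \<tau> f x \<le> 1" using assms bhp_semigroup_const_1 by simp
qed

lemma tasep_gen_bhp_semigroup:
  assumes x: "x \<in> configs" and \<tau>: "0 \<le> \<tau>"
  shows "tasep_gen (bhp_semigroup \<tau> f) x = exp (- \<tau>) * bhp_semigroup \<tau> (tasep_gen f) x"
proof -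
  \<comment> \<open>Written \<open>exp (1 * \<tau>)\<close> to match
    \<open>has_real_derivative_exp_mult\<close> with \<open>c = 1\<close>; differentiating this
    factor supplies the extra term of the commutator relation.\<close>
  let ?\<phi> = "\<lambda>\<tau> x. exp (1 * \<tau>) * tasep_gen (bhp_semigroup \<tau> f) x - bhp_semigroup \<tau> (tasep_gen f) x"
  have "?\<phi> \<tau> x = 0"
  proof (rule bhp_backward_unique[of ?\<phi>, OF _ _ x \<tau>])
    fix x and \<tau> :: real assume *: "x \<in> configs" "0 \<le> \<tau>"
    have deriv: "((\<lambda>\<tau>. tasep_gen (bhp_semigroup \<tau> f) x) has_real_derivative
        tasep_gen (bhp_gen (bhp_semigroup \<tau> f)) x) (at \<tau> within {0..})"
      by (intro has_real_derivative_generator bhp_semigroup_backward tasep_move_configs *)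
    have commute: "bhp_gen (tasep_gen (bhp_semigroup \<tau> f)) x =
        tasep_gen (bhp_gen (bhp_semigroup \<tau> f)) x + tasep_gen (bhp_semigroup \<tau> f) x"
      using bhp_tasep_commutator[OF *(1), of "bhp_semigroup \<tau> f"] by simp
    from DERIV_diff[OF has_real_derivative_exp_mult[OF deriv, of 1] bhp_semigroup_backward[OF *, of "tasep_gen f"]]
    show "((\<lambda>\<tau>. ?\<phi> \<tau> x) has_real_derivative bhp_gen (?\<phi> \<tau>) x) (at \<tau> within {0..})"
      by (rule DERIV_cong) (simp only: generator_diff generator_cmult mult_1 commute)
  next
    fix x assume x: "x \<in> configs"
    have "tasep_gen (bhp_semigroup 0 f) x = tasep_gen f x"
      by (intro generator_cong bhp_semigroup_0 tasep_move_configs x)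
    then show "?\<phi> 0 x = 0" by (simp add: bhp_semigroup_0[OF x])
  qed
  then show ?thesis by (simp add: exp_minus field_simps)
qed

text \<open>
  Comparison with the supersolution \<open>exp t * (area x + 2)\<close> of the TASEP backward equation, which
  exists because the jump rate grows at most linearly in the area. The induction descends from the
  states of large area, where the bound is an assumption.
\<close>

lemma tasep_backward_bound:
  assumes deriv: "\<And>x t. x \<in> configs \<Longrightarrow> 0 \<le> t \<Longrightarrow>
      ((\<lambda>t. D t x) has_real_derivative tasep_gen (D t) x) (at t within {0..})"
    and init: "\<And>x. x \<in> configs \<Longrightarrow> D 0 x \<le> K * (real_of_int (area x) + 2)"
    and far: "\<And>x t. x \<in> configs \<Longrightarrow> 0 \<le> t \<Longrightarrow> N < area x \<Longrightarrow> D t x \<le> K * (real_of_int (area x) + 2)"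
    and K: "0 \<le> K" and x: "x \<in> configs" and "0 \<le> t"
  shows "D t x \<le> K * exp t * (real_of_int (area x) + 2)"
  using x \<open>0 \<le> t\<close>
proof (induction "nat (N + 1 - area x)" arbitrary: x t rule: less_induct)
  case less
  note x = less.prems(1)
  let ?R = "running tasep_rate x" and ?a = "real_of_int (area x) + 2"
  define c where "c = real (card ?R)"
  have a: "c \<le> ?a" "0 \<le> c"
    using card_running_tasep_le[OF x] unfolding c_def by linarith+
  show ?case
  proof (cases "N < area x")
    case True
    have "K * ?a * 1 \<le> K * ?a * exp t"
      using K a less.prems(2) by (intro mult_left_mono) auto
    then show ?thesis using far[OF x less.prems(2) True] by (simp add: mult_ac)
  next
    case False
    \<comment> \<open>The gap to the supersolution, times an integrating factor that removes the
      diagonal part of the generator. The sign of the derivative of \<open>u\<close> then depends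
      only on the bounds at the successors of \<open>x\<close>, which have area larger by 1.\<close>
    define u where "u = (\<lambda>t. exp (c * t) * (K * ?a * exp t - D t x))"
    have u': "\<exists>u'. (u has_real_derivative u') (at s within {0..}) \<and> 0 \<le> u'" if s: "0 \<le> s" for s
    proof -
      have "D s (tasep_move x p) \<le> K * exp s * (?a + 1)" if p: "p \<in> ?R" for p
        using less.hyps[of "tasep_move x p" s] tasep_move_configs[OF x p] False s by simp
      then have "(\<Sum>p\<in>?R. D s (tasep_move x p)) \<le> (\<Sum>p\<in>?R. K * exp s * (?a + 1))"
        by (rule sum_mono)
      also have "\<dots> = K * exp s * (c * (?a + 1))" by (simp add: c_def)
      \<comment> \<open>The inequality \<open>c * (?a + 1) \<le> (c + 1) * ?a\<close> amounts to
        \<open>c \<le> ?a\<close>, the linear growth of the jump rate.\<close>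
      also have "\<dots> \<le> K * exp s * ((c + 1) * ?a)"
        using K a by (intro mult_left_mono) (auto simp: algebra_simps)
      finally have le: "(\<Sum>p\<in>?R. D s (tasep_move x p)) \<le> K * exp s * ((c + 1) * ?a)" .
      have gen: "tasep_gen (D s) x = (\<Sum>p\<in>?R. D s (tasep_move x p)) - c * D s x"
        by (simp add: tasep_gen_eq sum_subtractf c_def)
      have "((\<lambda>s. K * ?a * exp s - D s x) has_real_derivative K * ?a * exp s - tasep_gen (D s) x) (at s within {0..})"
        by (intro DERIV_diff DERIV_cmult deriv x s has_field_derivative_at_within[OF DERIV_exp])
      from has_real_derivative_exp_mult[OF this, of c]
      have "(u has_real_derivative exp (c * s) * (K * ?a * exp s - tasep_gen (D s) x + c * (K * ?a * exp s - D s x))) (at s within {0..})"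
        unfolding u_def .
      moreover have "0 \<le> K * ?a * exp s - tasep_gen (D s) x + c * (K * ?a * exp s - D s x)"
        using le unfolding gen by (simp add: algebra_simps)
      ultimately show ?thesis by (meson exp_ge_zero mult_nonneg_nonneg)
    qed
    have "u 0 \<le> u t"
    proof (rule DERIV_nonneg_imp_increasing_open[OF less.prems(2)])
      fix s :: real assume s: "0 < s" "s < t"
      then have "at s within {0..} = at s" by (intro at_within_interior) simp
      then show "\<exists>y. DERIV u s :> y \<and> 0 \<le> y" using u'[of s] s by simp
    next
      have "continuous_on {0..} u"
        unfolding continuous_on_eq_continuous_within using u' DERIV_continuous by fastforce
      then show "continuous_on {0..t} u" by (rule continuous_on_subset) auto
    qed
    moreover have "0 \<le> u 0" using init[OF x] by (simp add: u_def)
    ultimately have "0 \<le> u t" by linarith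
    then have "0 \<le> K * ?a * exp t - D t x" unfolding u_def by (simp only: zero_le_mult_iff) simp
    then show ?thesis by (simp add: mult_ac)
  qed
qed

section \<open>Comparison of the two composed semigroups\<close>

lemma bhp_semigroup_tasep_backward:
  assumes w: "w \<in> configs" and \<tau>: "0 \<le> \<tau>" and t: "0 \<le> t"
  shows "((\<lambda>t. bhp_semigroup \<tau> (\<lambda>z. tasep_trans (exp (- \<tau>) * t) z x) w) has_real_derivative
    tasep_gen (bhp_semigroup \<tau> (\<lambda>z. tasep_trans (exp (- \<tau>) * t) z x)) w) (at t within {0..})"
proof -
  let ?s = "exp (- \<tau>)"
  have "((\<lambda>t. tasep_trans (?s * t) z x) has_real_derivative tasep_gen (\<lambda>v. tasep_trans (?s * t) v x) z * ?s) (at t within {0..})"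
    if z: "z \<in> configs" for z
  proof (rule DERIV_image_chain[of "\<lambda>s. tasep_trans s z x" _ "\<lambda>t. ?s * t", unfolded o_def])
    have "((\<lambda>s. tasep_trans s z x) has_real_derivative tasep_gen (\<lambda>v. tasep_trans (?s * t) v x) z) (at (?s * t) within {0..})"
      using t by (intro tasep.transition_prob_backward z) simp
    then show "((\<lambda>s. tasep_trans s z x) has_real_derivative tasep_gen (\<lambda>v. tasep_trans (?s * t) v x) z) (at (?s * t) within (*) ?s ` {0..})"
      by (rule has_field_derivative_subset) auto
    show "((*) ?s has_real_derivative ?s) (at t within {0..})"
      by (auto intro!: derivative_eq_intros)
  qed
  then have "((\<lambda>t. bhp_semigroup \<tau> (\<lambda>z. tasep_trans (?s * t) z x) w) has_real_derivative
     (\<Sum>z\<in>{z \<in> configs. area z \<le> area w}. bhp_trans \<tau> w z * (tasep_gen (\<lambda>v. tasep_trans (?s * t) v x) z * ?s))) (at t within {0..})"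
    unfolding bhp_semigroup_def by (intro DERIV_sum DERIV_cmult) auto
  also have "(\<Sum>z\<in>{z \<in> configs. area z \<le> area w}. bhp_trans \<tau> w z * (tasep_gen (\<lambda>v. tasep_trans (?s * t) v x) z * ?s))
     = ?s * bhp_semigroup \<tau> (tasep_gen (\<lambda>v. tasep_trans (?s * t) v x)) w"
    by (simp add: bhp_semigroup_def sum_distrib_left mult_ac)
  \<comment> \<open>The chain-rule factor \<open>?s\<close> is exactly the one absorbed when the
    TASEP generator is pulled out of the BHP semigroup; this fixes the time scale.\<close>
  finally show ?thesis by (simp add: tasep_gen_bhp_semigroup[OF w \<tau>])
qed

text \<open>Both terms solve the TASEP backward equation and agree at time 0 on states of area at
  most \<open>N\<close>. On the remaining states the truncated sum vanishes at all times, because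
  TASEP never lowers the area, while the other term lies in \<open>[0, 1]\<close>. Applying
  \<open>tasep_backward_bound\<close> to both differences gives the absolute value.\<close>

lemma tasep_bhp_truncation_bound:
  assumes w: "w \<in> configs" and x: "x \<in> configs" and \<tau>: "0 \<le> \<tau>" and t: "0 \<le> t"
  shows "\<bar>bhp_semigroup \<tau> (\<lambda>z. tasep_trans (exp (- \<tau>) * t) z x) w
      - (\<Sum>z\<in>{z \<in> configs. area z \<le> int N}. tasep_trans t w z * bhp_trans \<tau> z x)\<bar>
    \<le> exp t * (real_of_int (area w) + 2) / (real N + 2)"
proof -
  let ?Z = "{z \<in> configs. area z \<le> int N}"
  define V where "V = (\<lambda>t w. bhp_semigroup \<tau> (\<lambda>z. tasep_trans (exp (- \<tau>) * t) z x) w)"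
  define W where "W = (\<lambda>t w. \<Sum>z\<in>?Z. tasep_trans t w z * bhp_trans \<tau> z x)"
  \<comment> \<open>Chosen so that \<open>K * (area w + 2) \<ge> 1\<close> whenever
    \<open>area w > N\<close>.\<close>
  define K where "K = 1 / (real N + 2)"
  have W': "((\<lambda>t. W t w) has_real_derivative tasep_gen (W t) w) (at t within {0..})"
    if "w \<in> configs" "0 \<le> t" for w t
  proof -
    have "((\<lambda>t. W t w) has_real_derivative (\<Sum>z\<in>?Z. tasep_gen (\<lambda>v. tasep_trans t v z) w * bhp_trans \<tau> z x)) (at t within {0..})"
      unfolding W_def by (intro DERIV_sum DERIV_cmult_right tasep.transition_prob_backward that)
    also have "(\<Sum>z\<in>?Z. tasep_gen (\<lambda>v. tasep_trans t v z) w * bhp_trans \<tau> z x) =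
       tasep_gen (\<lambda>v. \<Sum>z\<in>?Z. bhp_trans \<tau> z x * tasep_trans t v z) w"
      by (simp add: generator_sum generator_cmult mult.commute)
    also have "\<dots> = tasep_gen (W t) w" by (simp add: W_def mult.commute)
    finally show ?thesis .
  qed
  have V': "((\<lambda>t. V t w) has_real_derivative tasep_gen (V t) w) (at t within {0..})"
    if "w \<in> configs" "0 \<le> t" for w t
    unfolding V_def by (rule bhp_semigroup_tasep_backward[OF that(1) \<tau> that(2)])
  have V: "0 \<le> V t w" "V t w \<le> 1" if "w \<in> configs" for t w
    unfolding V_def using that \<tau>
    by (auto intro!: bhp_semigroup_bounds tasep.transition_prob_nonneg tasep.transition_prob_le_1)
  have K1: "1 \<le> K * (real_of_int (area w) + 2)" if "int N < area w" for w
    using that by (simp add: K_def field_simps)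
  have K0: "0 \<le> K" by (simp add: K_def)
  have far: "W t w = 0" if "w \<in> configs" "int N < area w" for t w
    unfolding W_def using that by (intro sum.neutral) (auto simp: tasep_trans_eq_0)
  have V0: "V 0 w = bhp_trans \<tau> w x" if w: "w \<in> configs" for w
  proof -
    have "V 0 w = (\<Sum>z\<in>{z \<in> configs. area z \<le> area w}. if z = x then bhp_trans \<tau> w z else 0)"
      unfolding V_def bhp_semigroup_def by (intro sum.cong) (auto simp: tasep.transition_prob_0)
    then show ?thesis using x finite_area_le bhp_trans_eq_0[OF w, of x] by (auto simp: not_le)
  qed
  have W0: "W 0 w = bhp_trans \<tau> w x" if "w \<in> configs" "area w \<le> int N" for w
  proof -
    have "W 0 w = (\<Sum>z\<in>?Z. if z = w then bhp_trans \<tau> z x else 0)"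
      unfolding W_def using that by (intro sum.cong) (auto simp: tasep.transition_prob_0)
    then show ?thesis using that finite_area_le by simp
  qed
  have abs_far: "\<bar>V t w - W t w\<bar> \<le> K * (real_of_int (area w) + 2)" if "w \<in> configs" "int N < area w" for t w
    using V[OF that(1)] far[OF that] K1[OF that(2)] by (smt (verit))
  have abs_init: "\<bar>V 0 w - W 0 w\<bar> \<le> K * (real_of_int (area w) + 2)" if "w \<in> configs" for w
  proof (cases "area w \<le> int N")
    case True
    then show ?thesis using V0[OF that] W0[OF that] K0 area_ge(1)[OF that] by simp
  qed (use abs_far that in simp)
  have "V t w - W t w \<le> K * exp t * (real_of_int (area w) + 2)"
  proof (rule tasep_backward_bound[of "\<lambda>t w. V t w - W t w" K "int N", OF _ _ _ K0 w t])
    show "((\<lambda>t. V t w - W t w) has_real_derivative tasep_gen (\<lambda>w. V t w - W t w) w) (at t within {0..})"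
      if "w \<in> configs" "0 \<le> t" for w t
      unfolding generator_diff by (intro DERIV_diff V' W' that)
  qed (use abs_init abs_far in \<open>simp_all add: abs_le_iff\<close>)
  moreover have "W t w - V t w \<le> K * exp t * (real_of_int (area w) + 2)"
  proof (rule tasep_backward_bound[of "\<lambda>t w. W t w - V t w" K "int N", OF _ _ _ K0 w t])
    show "((\<lambda>t. W t w - V t w) has_real_derivative tasep_gen (\<lambda>w. W t w - V t w) w) (at t within {0..})"
      if "w \<in> configs" "0 \<le> t" for w t
      unfolding generator_diff by (intro DERIV_diff V' W' that)
  qed (use abs_init abs_far in \<open>simp_all add: abs_le_iff\<close>)
  ultimately have "\<bar>V t w - W t w\<bar> \<le> K * exp t * (real_of_int (area w) + 2)" by (simp add: abs_le_iff)
  then show ?thesis by (simp add: V_def W_def K_def)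
qed

text \<open>The truncation bound tends to 0 as \<open>N\<close> grows, so the sums over area levels
  converge to the claimed value. The terms are nonnegative and every finite set of configurations
  lies below some level, which upgrades this to convergence along all finite sets.\<close>

theorem tasep_bhp_intertwining:
  assumes w: "w \<in> configs" and x: "x \<in> configs" and \<tau>: "0 \<le> \<tau>" and t: "0 \<le> t"
  shows "((\<lambda>z. tasep_trans t w z * bhp_trans \<tau> z x) has_sum
    bhp_semigroup \<tau> (\<lambda>z. tasep_trans (exp (- \<tau>) * t) z x) w) configs"
proof -
  let ?f = "\<lambda>z. tasep_trans t w z * bhp_trans \<tau> z x"
  let ?V = "bhp_semigroup \<tau> (\<lambda>z. tasep_trans (exp (- \<tau>) * t) z x) w"
  let ?Z = "\<lambda>N. {z \<in> configs. area z \<le> int N}"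
  have f0: "0 \<le> ?f z" for z
    by (simp add: bhp_trans_def bhp.transition_prob_nonneg tasep.transition_prob_nonneg)
  have "(\<lambda>N. sum ?f (?Z N) - ?V) \<longlonglongrightarrow> 0"
  proof (rule Lim_null_comparison)
    show "\<forall>\<^sub>F N in sequentially. norm (sum ?f (?Z N) - ?V) \<le> exp t * (real_of_int (area w) + 2) / (real N + 2)"
      using tasep_bhp_truncation_bound[OF assms] by (intro always_eventually) (simp add: abs_minus_commute)
    have "filterlim (\<lambda>N. 2 + real N) at_top sequentially"
      by (rule filterlim_tendsto_add_at_top[OF tendsto_const filterlim_real_sequentially])
    then have "filterlim (\<lambda>N. real N + 2) at_top sequentially" by (simp add: add.commute)
    then show "(\<lambda>N. exp t * (real_of_int (area w) + 2) / (real N + 2)) \<longlonglongrightarrow> 0"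
      by (rule real_tendsto_divide_at_top[OF tendsto_const])
  qed
  then have lim: "(\<lambda>N. sum ?f (?Z N)) \<longlonglongrightarrow> ?V" by (simp add: LIM_zero_iff)
  have mono: "incseq (\<lambda>N. sum ?f (?Z N))"
    by (intro incseq_SucI sum_mono2 finite_area_le f0) auto
  have cover: "\<exists>N. F \<subseteq> ?Z N" if "finite F" "F \<subseteq> configs" for F
    using that
  proof (intro exI[of _ "nat (Max (insert 0 (area ` F)))"] subsetI)
    fix z assume "z \<in> F"
    then have "area z \<le> Max (insert 0 (area ` F))" using that by (intro Max_ge) auto
    then show "z \<in> ?Z (nat (Max (insert 0 (area ` F))))" using \<open>z \<in> F\<close> that by auto
  qed
  show ?thesis
    unfolding has_sum_def
  proof (rule order_tendstoI)
    fix a assume "a < ?V"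
    then obtain N where N: "a < sum ?f (?Z N)"
      using order_tendstoD(1)[OF lim] unfolding eventually_sequentially by blast
    show "\<forall>\<^sub>F F in finite_subsets_at_top configs. a < sum ?f F"
      unfolding eventually_finite_subsets_at_top
    proof (intro exI[of _ "?Z N"] conjI allI impI)
      fix F assume F: "finite F \<and> ?Z N \<subseteq> F \<and> F \<subseteq> configs"
      then have "sum ?f (?Z N) \<le> sum ?f F" by (intro sum_mono2 f0) auto
      then show "a < sum ?f F" using N by simp
    qed (auto intro: finite_area_le)
  next
    fix b assume b: "?V < b"
    have "sum ?f F < b" if F: "finite F" "F \<subseteq> configs" for F
    proof -
      obtain N where "F \<subseteq> ?Z N" using cover[OF F] by blast
      then have "sum ?f F \<le> sum ?f (?Z N)" by (intro sum_mono2 finite_area_le f0)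
      also have "\<dots> \<le> ?V" by (rule incseq_le[OF mono lim])
      finally show ?thesis using b by simp
    qed
    then show "\<forall>\<^sub>F F in finite_subsets_at_top configs. sum ?f F < b"
      unfolding eventually_finite_subsets_at_top by (intro exI[of _ "{}"]) auto
  qed
qed

theorem theorem1:
  fixes t \<tau> :: real and x :: "int set"
  assumes "t \<ge> 0" and "\<tau> \<ge> 0" and "x \<in> configs"
  shows "((\<lambda>y. tasep_law t y * bhp_trans \<tau> y x) has_sum tasep_law (exp (- \<tau>) * t) x) configs"
proof -
  \<comment> \<open>All holes of the step configuration lie to the right of all its particles, so no
    BHP clock runs and \<open>L\<^sub>\<tau>\<close> acts there as evaluation.\<close>
  have running: "running bhp_rate step_config = {}"
    using running_bhp[OF step_config_in_configs] by (auto simp: step_config_eq)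
  have "bhp_semigroup \<tau> f step_config = f step_config" for f
  proof -
    have "bhp_semigroup \<tau> f step_config = (\<Sum>z\<in>{z \<in> configs. area z \<le> 0}. if z = step_config then f z else 0)"
      unfolding bhp_semigroup_def bhp_trans_def area_step_config
      by (intro sum.cong) (auto simp: bhp.transition_prob_absorbing[OF step_config_in_configs assms(2) running])
    then show ?thesis using finite_area_le step_config_in_configs by (simp add: area_step_config)
  qed
  then show ?thesis
    using tasep_bhp_intertwining[OF step_config_in_configs assms(3,2,1)] by (simp add: tasep_law_def)
qed

end
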